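(* Let $k$ be any field with $\operatorname{char} k=0$, and let $M$ be an intermediate field $k\subsetneq M\subsetneq k(\mathbf{x})$ satisfying condition $(\dag)$ below. Put $R:=M\cap k[\mathbf{x}]$ and $\overline{R}:=\epsilon(R)$. Let $h\in Q(\overline{R})\cap k[x_1]$ with $h\notin\overline{R}$, let $f,g\in R$ with $\epsilon(g)\ne 0$ and $\epsilon(f)/\epsilon(g)=h$, let $\Pi(z)$ be a monic polynomial in $z$ over $k[g]$ with $\epsilon(\Pi(f))=0$, and put $\pi:=\Pi(f)\in k[f,g]$. Let $t=(t_i)_{i=2}^n\in\mathbf{Z}^{n-1}$, and let $\theta:=\theta_t^h$ be the automorphism defined in the context. Assume that condition $(\ddag)$ holds: $$\theta(f-gh)\in k[\mathbf{x}]\quad\text{and}\quad \theta(\pi)\in x_1k[\mathbf{x}].$$ Then the $k$-algebra $\mathcal{A}:=\theta(M(z))\cap k[\mathbf{x},z]$ is not finitely generated and $Q(\mathcal{A})=\theta(M(z))$.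
   Context: $k[\mathbf{x}]=k[x_1,\ldots,x_n]$ and $k[\mathbf{x},z]=k[x_1,\ldots,x_n,z]$ are polynomial rings over $k$, with fields of fractions $k(\mathbf{x})$ and $k(\mathbf{x},z)$. For an integral domain $B$, $Q(B)$ is its field of fractions, and $B_b:=B[1/b]$ for $b\in B\setminus\{0\}$. For a $k$-domain $B$, $\operatorname{Aut}_kB$ is regarded as a subgroup of $\operatorname{Aut}_kQ(B)$. A domain is normal if it is integrally closed in its field of fractions. The map $\epsilon:k[\mathbf{x}]\to k[x_1]$ is the $k$-algebra homomorphism with $\epsilon(x_1)=x_1$ and $\epsilon(x_i)=0$ for $i=2,\ldots,n$. Condition $(\dag)$ on $M$: with $R:=M\cap k[\mathbf{x}]$, one has $M\cap k[\mathbf{x}]=M\cap k[\mathbf{x}]_{x_1}$, $Q(R)=M$, and $\overline{R}:=\epsilon(R)$ is not normal. For $t=(t_i)_{i=2}^n\in\mathbf{Z}^{n-1}$ and $h\in k[x_1]$, $\theta_t^h\in\operatorname{Aut}_k k[\mathbf{x},z]_{x_1}$ is defined by $\theta_t^h(x_1)=x_1^{-1}$, $\theta_t^h(x_i)=x_1^{t_i}x_i$ for $i=2,\ldots,n$, and $\theta_t^h(z)=z+\theta_t^h(h)$, where $\theta_t^h(h)=h(x_1^{-1})$. It is extended to an automorphism of $k(\mathbf{x},z)$. $M(z)$ is the subfield of $k(\mathbf{x},z)$ generated by $M$ and $z$. *)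

theory Defs
  imports "HOL-Computational_Algebra.Computational_Algebra" "HOL-Library.Poly_Mapping"
begin

text \<open>Polynomials over \<open>'k\<close> in countably many variables, indexed by \<^typ>\<open>nat\<close>. The variable
  with index \<open>i \<in> {1..n}\<close> is \<open>x\<^sub>i\<close> and the variable with index \<open>0\<close> is \<open>z\<close>; the rings
  \<open>k[x]\<close> and \<open>k[x,z]\<close> are the subrings of polynomials in the respective variables.\<close>

type_synonym 'k mpoly = "(nat \<Rightarrow>\<^sub>0 nat) \<Rightarrow>\<^sub>0 'k"

definition Const :: "'k::zero \<Rightarrow> 'k mpoly" where
  "Const c = Poly_Mapping.single 0 c"

definition Var :: "nat \<Rightarrow> 'k::zero_neq_one mpoly" where
  "Var i = Poly_Mapping.single (Poly_Mapping.single i 1) 1"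

definition vars :: "'k::zero mpoly \<Rightarrow> nat set" where
  "vars p = (\<Union>m\<in>Poly_Mapping.keys p. Poly_Mapping.keys m)"

definition polys_in :: "nat set \<Rightarrow> 'k::zero mpoly set" where
  "polys_in V = {p. vars p \<subseteq> V}"

text \<open>Evaluation of \<open>p\<close> at \<open>s\<close>, where the coefficients are mapped by \<open>c\<close>.\<close>

definition peval :: "('k::zero \<Rightarrow> 'b::comm_ring_1) \<Rightarrow> (nat \<Rightarrow> 'b) \<Rightarrow> 'k mpoly \<Rightarrow> 'b" where
  "peval c s p = (\<Sum>m\<in>Poly_Mapping.keys p.
     c (Poly_Mapping.lookup p m) * (\<Prod>i\<in>Poly_Mapping.keys m. s i ^ Poly_Mapping.lookup m i))"

definition constants :: "'k::field mpoly fract set" where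
  "constants = range (\<lambda>c. to_fract (Const c))"


definition is_subring :: "'a::comm_ring_1 set \<Rightarrow> bool" where
  "is_subring B \<longleftrightarrow> 1 \<in> B \<and> (\<forall>a\<in>B. \<forall>b\<in>B. a - b \<in> B \<and> a * b \<in> B)"

definition is_subfield :: "'a::field set \<Rightarrow> bool" where
  "is_subfield L \<longleftrightarrow> is_subring L \<and> (\<forall>a\<in>L. inverse a \<in> L)"

definition ring_adjoin :: "'a::comm_ring_1 set \<Rightarrow> 'a set \<Rightarrow> 'a set" where
  "ring_adjoin B S = is_subring hull (B \<union> S)"

definition field_adjoin :: "'a::field set \<Rightarrow> 'a set \<Rightarrow> 'a set" where
  "field_adjoin L S = is_subfield hull (L \<union> S)"

text \<open>The field of fractions of a subring \<open>B\<close> of a field, formed inside that field.\<close>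

definition quot_field :: "'a::field set \<Rightarrow> 'a set" where
  "quot_field B = {a / b | a b. a \<in> B \<and> b \<in> B \<and> b \<noteq> 0}"

definition localize :: "'a::field set \<Rightarrow> 'a \<Rightarrow> 'a set" where
  "localize B b = ring_adjoin B {1 / b}"

definition integral_over :: "'a::comm_ring_1 set \<Rightarrow> 'a \<Rightarrow> bool" where
  "integral_over B y \<longleftrightarrow>
     (\<exists>p. lead_coeff p = 1 \<and> (\<forall>i. coeff p i \<in> B) \<and> poly p y = 0)"

definition is_normal :: "'a::field set \<Rightarrow> bool" where
  "is_normal B \<longleftrightarrow> (\<forall>y\<in>quot_field B. integral_over B y \<longrightarrow> y \<in> B)"

definition finitely_generated_algebra :: "'a::comm_ring_1 set \<Rightarrow> 'a set \<Rightarrow> bool" where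
  "finitely_generated_algebra K A \<longleftrightarrow> (\<exists>S. finite S \<and> S \<subseteq> A \<and> A = ring_adjoin K S)"


text \<open>The map \<open>\<epsilon>\<close> sending \<open>x\<^sub>1\<close> to \<open>x\<^sub>1\<close> and the other variables to 0; it is only used on \<open>k[x]\<close>.\<close>

definition eps :: "'k::field mpoly \<Rightarrow> 'k mpoly" where
  "eps = peval Const (\<lambda>i. if i = 1 then Var 1 else 0)"

text \<open>The images of the variables under \<open>\<theta>\<close>. In the image of \<open>z\<close>, all variables
  of \<open>h\<close> may be replaced by \<open>1 / x\<^sub>1\<close> because \<open>h \<in> k[x\<^sub>1]\<close>, so that the second summand
  is \<open>h(1 / x\<^sub>1)\<close>. The unused variables with index \<open>> n\<close> are fixed.\<close>

definition theta_var :: "nat \<Rightarrow> (nat \<Rightarrow> int) \<Rightarrow> 'k::field mpoly \<Rightarrow> nat \<Rightarrow> 'k mpoly fract" where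
  "theta_var n t h i =
     (if i = 0 then to_fract (Var 0) + peval (\<lambda>c. to_fract (Const c)) (\<lambda>_. 1 / to_fract (Var 1)) h
      else if i = 1 then 1 / to_fract (Var 1)
      else if i \<le> n then to_fract (Var 1) powi t i * to_fract (Var i)
      else to_fract (Var i))"

definition theta_poly :: "nat \<Rightarrow> (nat \<Rightarrow> int) \<Rightarrow> 'k::field mpoly \<Rightarrow> 'k mpoly \<Rightarrow> 'k mpoly fract" where
  "theta_poly n t h = peval (\<lambda>c. to_fract (Const c)) (theta_var n t h)"

text \<open>The extension of \<open>\<theta>\<close> to fractions; the value does not depend on the chosen
  representation \<open>a / b\<close>, because \<open>theta_poly\<close> is an injective ring homomorphism for
  \<open>h \<in> k[x\<^sub>1]\<close>: the substitution \<open>x\<^sub>1 \<mapsto> 1 / x\<^sub>1\<close>, \<open>x\<^sub>i \<mapsto> x\<^sub>1\<^bsup>t\<^sub>i\<^esup> x\<^sub>i\<close>, \<open>z \<mapsto> z - h\<close> inverts it.\<close>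

definition theta :: "nat \<Rightarrow> (nat \<Rightarrow> int) \<Rightarrow> 'k::field mpoly \<Rightarrow> 'k mpoly fract \<Rightarrow> 'k mpoly fract" where
  "theta n t h q =
     (THE r. \<exists>a b. b \<noteq> 0 \<and> q = to_fract a / to_fract b \<and> r = theta_poly n t h a / theta_poly n t h b)"

end

theory Submission
  imports Defs
begin

text \<open>Write \<open>R = M \<inter> k[x]\<close>. Since \<open>M(z)\<close> meets the localization of \<open>k[x,z]\<close> at \<open>x\<^sub>1\<close> in \<open>R[z]\<close>, every
  element of \<open>A\<close> is \<open>\<theta>(p)\<close> with \<open>p \<in> R[z]\<close>. Applying \<open>\<epsilon>\<close> shows that \<open>\<epsilon>(p) \<in> k[z - h]\<close>, and then \<open>h \<notin> \<epsilon>(R)\<close> forces \<open>\<epsilon>(p) \<in> k\<close>. So a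
  nonconstant monomial of \<open>p\<close> has positive degree in \<open>x\<^sub>2,\<dots>,x\<^sub>n\<close>, and if \<open>A\<close> were finitely generated, its
  degree in \<open>z\<close> would be at most a fixed multiple of its degree in \<open>x\<^sub>2,\<dots>,x\<^sub>n\<close>.

  On the other hand, for a fixed \<open>l\<close> and all \<open>N\<close> there is an element of \<open>R[z]\<close> with leading term \<open>\<pi>\<^sup>l z\<^sup>N\<close> and
  \<open>\<theta>\<close>-image in \<open>A\<close>, namely an Appell sequence \<open>q\<^sub>N = \<Sum>\<^sub>i binom(N, i) r\<^sub>N\<^sub>-\<^sub>i z\<^sup>i\<close>. By Taylor expansion at \<open>f/g\<close> it is enough
  that \<open>\<theta>(q\<^sub>N(f/g))\<close> has no pole along \<open>x\<^sub>1 = 0\<close>, because \<open>h - f/g = -(f - gh)/g\<close> has this property. One finds \<open>r\<^sub>N\<close>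
  by expanding the other summands of \<open>q\<^sub>N(f/g)\<close> in the elements \<open>\<pi>\<^sup>a f\<^sup>j g\<^sup>s\<close> with \<open>j < deg \<Pi>\<close>: those with \<open>s \<ge> 0\<close> lie in \<open>R\<close>,
  and those with \<open>s < 0\<close> have no pole for large \<open>l\<close>.

  Finally \<open>\<pi> \<noteq> 0\<close>: otherwise \<open>\<epsilon>\<close> is injective on \<open>k[f,g]\<close>, \<open>f/g\<close> is almost integral over \<open>k[x]\<close> because \<open>h\<close> is
  almost integral over \<open>k[\<epsilon>(f),\<epsilon>(g)]\<close>, and \<open>f/g\<close> would be an element of \<open>R\<close> with image \<open>h\<close>.\<close>

section \<open>Polynomials and substitution\<close>

locale rhom =
  fixes \<phi> :: "'a::comm_ring_1 \<Rightarrow> 'b::comm_ring_1"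
  assumes one [simp]: "\<phi> 1 = 1"
    and add [simp]: "\<phi> (x + y) = \<phi> x + \<phi> y"
    and mult [simp]: "\<phi> (x * y) = \<phi> x * \<phi> y"
begin

lemma zero [simp]: "\<phi> 0 = 0"
  using add[of 0 0] by simp

lemma uminus [simp]: "\<phi> (- x) = - \<phi> x"
  using add[of x "- x"] by (simp add: eq_neg_iff_add_eq_0 add.commute)

lemma diff [simp]: "\<phi> (x - y) = \<phi> x - \<phi> y"
  using add[of x "- y"] by simp

lemma power [simp]: "\<phi> (x ^ k) = \<phi> x ^ k"
  by (induction k) simp_all

lemma of_nat [simp]: "\<phi> (of_nat k) = of_nat k"
  by (induction k) simp_all

lemma sum [simp]: "\<phi> (sum f A) = (\<Sum>x\<in>A. \<phi> (f x))"
  by (induction A rule: infinite_finite_induct) simp_all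

lemma poly: "\<phi> (poly Q y) = poly (map_poly \<phi> Q) (\<phi> y)"
  by (induction Q) (simp_all add: map_poly_pCons)

end

lemma rhom_to_fract: "rhom (to_fract :: 'a::idom \<Rightarrow> _)"
  by unfold_locales simp_all

lemma rhom_Const: "rhom (Const :: 'k::comm_ring_1 \<Rightarrow> _)"
  by unfold_locales (simp_all add: Const_def single_add mult_single)

lemma rhom_comp: "rhom \<phi> \<Longrightarrow> rhom \<psi> \<Longrightarrow> rhom (\<lambda>x. \<psi> (\<phi> x))"
  by (simp add: rhom_def)

interpretation to_fract: rhom "to_fract :: 'a::idom \<Rightarrow> _"
  by (rule rhom_to_fract)

interpretation Const: rhom "Const :: 'k::comm_ring_1 \<Rightarrow> _"
  by (rule rhom_Const)

lemma Const_eq_0_iff [simp]: "Const c = 0 \<longleftrightarrow> c = 0"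
  by (metis Const_def lookup_single_eq lookup_zero single_zero)

lemma lookup_Const_mult: "Poly_Mapping.lookup (Const c * p) m = c * Poly_Mapping.lookup (p :: 'k::comm_ring_1 mpoly) m"
  unfolding Const_def mult_map_scale_conv_mult[symmetric] by transfer (simp add: when_def)

lemma single_mult_Const: "Poly_Mapping.single m (c :: 'k::comm_ring_1) = Const c * Poly_Mapping.single m 1"
  by (simp add: Const_def mult_single)

lemma poly_mapping_sum_single:
  "(p :: 'm \<Rightarrow>\<^sub>0 'k::comm_monoid_add) = (\<Sum>m\<in>Poly_Mapping.keys p. Poly_Mapping.single m (Poly_Mapping.lookup p m))"
proof (rule poly_mapping_eqI)
  fix k
  have "(\<Sum>m\<in>Poly_Mapping.keys p. Poly_Mapping.lookup (Poly_Mapping.single m (Poly_Mapping.lookup p m)) k)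
      = (\<Sum>m\<in>Poly_Mapping.keys p. if k = m then Poly_Mapping.lookup p m else 0)"
    by (intro sum.cong) (auto simp: lookup_single when_def)
  also have "\<dots> = Poly_Mapping.lookup p k"
    by (simp add: in_keys_iff)
  finally show "Poly_Mapping.lookup p k = Poly_Mapping.lookup (\<Sum>m\<in>Poly_Mapping.keys p. Poly_Mapping.single m (Poly_Mapping.lookup p m)) k"
    by (simp add: lookup_sum)
qed

definition mon_val :: "(nat \<Rightarrow> 'b::comm_ring_1) \<Rightarrow> (nat \<Rightarrow>\<^sub>0 nat) \<Rightarrow> 'b" where
  "mon_val s m = (\<Prod>i\<in>Poly_Mapping.keys m. s i ^ Poly_Mapping.lookup m i)"

lemma mon_val_superset:
  "finite A \<Longrightarrow> Poly_Mapping.keys m \<subseteq> A \<Longrightarrow> mon_val s m = (\<Prod>i\<in>A. s i ^ Poly_Mapping.lookup m i)"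
  unfolding mon_val_def by (rule prod.mono_neutral_left) (auto simp: in_keys_iff)

lemma mon_val_0 [simp]: "mon_val s 0 = 1"
  by (simp add: mon_val_def)

lemma mon_val_add: "mon_val s (m + m') = mon_val s m * mon_val s m'"
proof -
  let ?A = "Poly_Mapping.keys m \<union> Poly_Mapping.keys m'"
  have "mon_val s (m + m') = (\<Prod>i\<in>?A. s i ^ Poly_Mapping.lookup (m + m') i)"
    by (rule mon_val_superset) (use keys_add[of m m'] in auto)
  also have "\<dots> = (\<Prod>i\<in>?A. s i ^ Poly_Mapping.lookup m i) * (\<Prod>i\<in>?A. s i ^ Poly_Mapping.lookup m' i)"
    by (simp add: lookup_add power_add prod.distrib)
  also have "(\<Prod>i\<in>?A. s i ^ Poly_Mapping.lookup m i) = mon_val s m"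
    by (rule mon_val_superset[symmetric]) auto
  also have "(\<Prod>i\<in>?A. s i ^ Poly_Mapping.lookup m' i) = mon_val s m'"
    by (rule mon_val_superset[symmetric]) auto
  finally show ?thesis .
qed

lemma mon_val_single [simp]: "mon_val s (Poly_Mapping.single i k) = s i ^ k"
  by (cases "k = 0") (simp_all add: mon_val_def)

lemma single_sum_mon: "Poly_Mapping.single (m + m') (1::'k::comm_ring_1) = Poly_Mapping.single m 1 * Poly_Mapping.single m' 1"
  by (simp add: mult_single)

lemma Var_power: "(Var i :: 'k::comm_ring_1 mpoly) ^ k = Poly_Mapping.single (Poly_Mapping.single i k) 1"
  by (induction k) (simp_all add: Var_def mult_single single_add[symmetric])

lemma single_eq_mon_val: "Poly_Mapping.single m (1::'k::comm_ring_1) = mon_val Var m"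
proof -
  have "Poly_Mapping.single (\<Sum>i\<in>A. Poly_Mapping.single i (f i)) (1::'k) = (\<Prod>i\<in>A. Var i ^ f i)"
    if "finite A" for A :: "nat set" and f :: "nat \<Rightarrow> nat"
    using that by induction (simp_all add: single_sum_mon Var_power)
  from this[of "Poly_Mapping.keys m" "Poly_Mapping.lookup m"] show ?thesis
    unfolding mon_val_def by (simp add: poly_mapping_sum_single[symmetric, of m])
qed

lemma peval_mon_val: "peval c s p = (\<Sum>m\<in>Poly_Mapping.keys p. c (Poly_Mapping.lookup p m) * mon_val s m)"
  by (simp add: peval_def mon_val_def)

lemma peval_superset:
  assumes "c 0 = 0" "finite A" "Poly_Mapping.keys p \<subseteq> A"
  shows "peval c s p = (\<Sum>m\<in>A. c (Poly_Mapping.lookup p m) * mon_val s m)"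
  unfolding peval_mon_val by (rule sum.mono_neutral_left) (use assms in \<open>auto simp: in_keys_iff\<close>)

lemma peval_single: "rhom c \<Longrightarrow> peval c s (Poly_Mapping.single m a) = c a * mon_val s m"
  by (subst peval_superset[of _ "{m}"]) (auto simp: rhom.zero)

lemma rhom_peval:
  fixes c :: "'k::comm_ring_1 \<Rightarrow> 'b::comm_ring_1"
  assumes "rhom c"
  shows "rhom (peval c s)"
proof -
  interpret c: rhom c by fact
  have add: "peval c s (p + q) = peval c s p + peval c s q" for p q
  proof -
    let ?A = "Poly_Mapping.keys p \<union> Poly_Mapping.keys q"
    have *: "Poly_Mapping.keys (p + q) \<subseteq> ?A" "Poly_Mapping.keys p \<subseteq> ?A" "Poly_Mapping.keys q \<subseteq> ?A" "finite ?A"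
      using keys_add[of p q] by auto
    note sup = peval_superset[of c, OF c.zero *(4)]
    show ?thesis
      unfolding sup[OF *(1)] sup[OF *(2)] sup[OF *(3)]
      by (simp add: lookup_add sum.distrib distrib_right)
  qed
  have sum: "peval c s (sum f A) = (\<Sum>x\<in>A. peval c s (f x))" for f and A :: "'x set"
    by (induction A rule: infinite_finite_induct) (simp_all add: add, simp_all add: peval_def)
  have "peval c s (p * q) = peval c s p * peval c s q" for p q
  proof -
    let ?s = "\<lambda>p m. Poly_Mapping.single m (Poly_Mapping.lookup p m)"
    have "p * q = (\<Sum>m\<in>Poly_Mapping.keys p. ?s p m) * (\<Sum>m\<in>Poly_Mapping.keys q. ?s q m)"
      by (simp add: poly_mapping_sum_single[symmetric])
    also have "\<dots> = (\<Sum>m\<in>Poly_Mapping.keys p. \<Sum>m'\<in>Poly_Mapping.keys q. ?s p m * ?s q m')"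
      by (rule sum_product)
    also have "peval c s \<dots> = (\<Sum>m\<in>Poly_Mapping.keys p. \<Sum>m'\<in>Poly_Mapping.keys q. peval c s (?s p m) * peval c s (?s q m'))"
      by (simp add: sum mult_single peval_single[OF assms] mon_val_add mult_ac)
    also have "\<dots> = peval c s p * peval c s q"
      unfolding peval_single[OF assms] peval_mon_val[of c s p] peval_mon_val[of c s q] sum_product ..
    finally show ?thesis .
  qed
  moreover have "peval c s 1 = 1"
    using peval_single[OF assms, of s 0 1] by simp
  ultimately show ?thesis
    using add by (intro rhom.intro)
qed

lemma peval_Const: "rhom c \<Longrightarrow> peval c s (Const a) = c a"
  by (simp add: Const_def peval_single)

lemma peval_Var: "rhom c \<Longrightarrow> peval c s (Var i) = s i"
  by (simp add: Var_def peval_single rhom.one)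

lemma polys_in_iff: "p \<in> polys_in V \<longleftrightarrow> (\<forall>m\<in>Poly_Mapping.keys p. Poly_Mapping.keys m \<subseteq> V)"
  by (auto simp: polys_in_def vars_def)

lemma polys_in_lookup: "p \<in> polys_in V \<Longrightarrow> m \<in> Poly_Mapping.keys p \<Longrightarrow> i \<notin> V \<Longrightarrow> Poly_Mapping.lookup m i = 0"
  unfolding polys_in_iff by (metis in_keys_iff subsetD)

lemma polys_in_mono: "V \<subseteq> W \<Longrightarrow> polys_in V \<subseteq> polys_in W"
  by (auto simp: polys_in_def)

lemma polys_in_UNIV [simp]: "polys_in UNIV = UNIV"
  by (auto simp: polys_in_def)

lemma Const_in_polys [simp]: "Const c \<in> polys_in V"
  by (auto simp: polys_in_iff Const_def)

lemma zero_in_polys [simp]: "0 \<in> polys_in V"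
  by (auto simp: polys_in_iff)

lemma one_in_polys [simp]: "1 \<in> polys_in V"
  by (auto simp: polys_in_iff)

lemma Var_in_polys: "i \<in> V \<Longrightarrow> Var i \<in> polys_in V"
  by (auto simp: polys_in_iff Var_def)

lemma add_in_polys: "p \<in> polys_in V \<Longrightarrow> q \<in> polys_in V \<Longrightarrow> p + q \<in> polys_in V"
  using keys_add[of p q] by (fastforce simp: polys_in_iff)

lemma uminus_in_polys: "(p :: 'k::comm_ring_1 mpoly) \<in> polys_in V \<Longrightarrow> - p \<in> polys_in V"
  by (auto simp: polys_in_iff in_keys_iff)

lemma diff_in_polys: "(p :: 'k::comm_ring_1 mpoly) \<in> polys_in V \<Longrightarrow> q \<in> polys_in V \<Longrightarrow> p - q \<in> polys_in V"
  using add_in_polys[of p V "- q"] uminus_in_polys[of q V] by simp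

lemma mult_in_polys: "(p :: 'k::comm_ring_1 mpoly) \<in> polys_in V \<Longrightarrow> q \<in> polys_in V \<Longrightarrow> p * q \<in> polys_in V"
  unfolding polys_in_iff
proof
  fix m assume pq: "\<forall>m\<in>Poly_Mapping.keys p. Poly_Mapping.keys m \<subseteq> V" "\<forall>m\<in>Poly_Mapping.keys q. Poly_Mapping.keys m \<subseteq> V"
    and "m \<in> Poly_Mapping.keys (p * q)"
  then obtain a b where "m = a + b" "a \<in> Poly_Mapping.keys p" "b \<in> Poly_Mapping.keys q"
    using keys_mult[of p q] by auto
  with pq keys_add[of a b] show "Poly_Mapping.keys m \<subseteq> V" by blast
qed

lemma is_subring_polys_in: "is_subring (polys_in V :: 'k::comm_ring_1 mpoly set)"
  by (auto simp: is_subring_def diff_in_polys mult_in_polys)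

text \<open>Monomials are products of powers of variables, so a property stable under sums and
  products has to be checked on constants and variables only. Most facts about substitutions below
  are proved in this way.\<close>

lemma mpoly_induct [consumes 1, case_names Const Var add mult]:
  assumes "p \<in> polys_in V" "\<And>c. P (Const c)" "\<And>i. i \<in> V \<Longrightarrow> P (Var i)"
    and add: "\<And>p q. P p \<Longrightarrow> P q \<Longrightarrow> P (p + q)"
    and mult: "\<And>p q. P p \<Longrightarrow> P q \<Longrightarrow> P (p * q)"
  shows "P (p :: 'k::comm_ring_1 mpoly)"
proof -
  have 0: "P 0" and 1: "P 1"
    using assms(2)[of 0] assms(2)[of 1] by simp_all
  have pow: "P (Var i ^ k)" if "i \<in> V" for i k
    by (induction k) (use 1 that assms in auto)
  have pr: "finite A \<Longrightarrow> A \<subseteq> V \<Longrightarrow> P (\<Prod>i\<in>A. Var i ^ f i)" for A f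
    by (induction A rule: finite_induct) (use 1 pow mult in auto)
  have "P (Poly_Mapping.single m c)" if "Poly_Mapping.keys m \<subseteq> V" for m c
    using mult[OF assms(2)[of c] pr[OF _ that, of "Poly_Mapping.lookup m"]]
    by (subst single_mult_Const) (simp add: single_eq_mon_val mon_val_def)
  moreover have "finite A \<Longrightarrow> (\<And>m. m \<in> A \<Longrightarrow> P (F m)) \<Longrightarrow> P (sum F A)" for F and A :: "(nat \<Rightarrow>\<^sub>0 nat) set"
    by (induction A rule: finite_induct) (use 0 add in auto)
  ultimately show ?thesis
    using assms(1) by (subst poly_mapping_sum_single) (simp add: polys_in_iff)
qed

lemma peval_cong:
  assumes "p \<in> polys_in V" "\<And>i. i \<in> V \<Longrightarrow> s i = s' i"
  shows "peval c s p = peval c s' p"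
  unfolding peval_def
  using assms by (intro sum.cong prod.cong arg_cong2[where f="(*)"] refl) (metis polys_in_iff subsetD)

lemma rhom_eq_on_polys:
  fixes \<phi> \<psi> :: "'k::comm_ring_1 mpoly \<Rightarrow> 'b::comm_ring_1"
  assumes "rhom \<phi>" "rhom \<psi>" "p \<in> polys_in V" "\<And>c. \<phi> (Const c) = \<psi> (Const c)" "\<And>i. i \<in> V \<Longrightarrow> \<phi> (Var i) = \<psi> (Var i)"
  shows "\<phi> p = \<psi> p"
  using assms(3) by (induction rule: mpoly_induct) (use assms in \<open>auto simp: rhom_def\<close>)

lemma rhom_const_fract: "rhom (\<lambda>c::'k::field. to_fract (Const c))"
  by (intro rhom_comp[OF rhom_Const rhom_to_fract])

lemma Var_neq_0 [simp]: "(Var i :: 'k::field mpoly) \<noteq> 0"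
  by (metis Var_def keys_single keys_zero insert_not_empty one_neq_zero)

lemma theta_poly_rhom: "rhom (theta_poly n t h)"
  unfolding theta_poly_def by (rule rhom_peval[OF rhom_const_fract])

section \<open>The substitution \<theta> and its inverse\<close>

locale theta_subst =
  fixes n :: nat and t :: "nat \<Rightarrow> int" and h :: "'k::field_char_0 mpoly"
  assumes h_in: "h \<in> polys_in {1}"
begin

abbreviation X :: "'k mpoly fract" where "X \<equiv> to_fract (Var 1)"

abbreviation "tp \<equiv> theta_poly n t h"

sublocale tp: rhom tp
  by (rule theta_poly_rhom)

lemma tp_Const [simp]: "tp (Const c) = to_fract (Const c)"
  by (simp add: theta_poly_def peval_Const rhom_const_fract)

lemma tp_Var: "tp (Var i) = theta_var n t h i"
  by (simp add: theta_poly_def peval_Var rhom_const_fract)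

lemma tp_X [simp]: "tp (Var 1) = 1 / X" "tp (Var (Suc 0)) = 1 / X"
  by (simp_all add: tp_Var theta_var_def)

lemma tp_h: "tp h = peval (\<lambda>c. to_fract (Const c)) (\<lambda>_. 1 / X) h"
  unfolding theta_poly_def by (rule peval_cong[OF h_in]) (simp add: theta_var_def)

lemma tp_z: "tp (Var 0) = to_fract (Var 0) + tp h"
  by (simp add: tp_Var theta_var_def tp_h)

lemma tp_Var_pos: "i > 0 \<Longrightarrow> \<exists>d. tp (Var i) = X powi d * to_fract (if i = 1 then 1 else Var i)"
  by (auto simp: tp_Var theta_var_def power_int_minus field_simps intro: exI[of _ "- 1"] exI[of _ "0"])

text \<open>On the variables other than z, \<theta> is an involution, because the factor x_1^(t_i)
  in the image of x_i is inverted by a second application. Only the image of z has to be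
  altered.\<close>

definition theta_inv :: "'k mpoly \<Rightarrow> 'k mpoly fract" where
  "theta_inv = peval (\<lambda>c. to_fract (Const c)) (\<lambda>i. if i = 0 then to_fract (Var 0 - h) else theta_var n t h i)"

lemma theta_inv_rhom: "rhom theta_inv"
  unfolding theta_inv_def by (rule rhom_peval[OF rhom_const_fract])

sublocale theta_inv: rhom theta_inv
  by (rule theta_inv_rhom)

lemma theta_inv_Const [simp]: "theta_inv (Const c) = to_fract (Const c)"
  by (simp add: theta_inv_def peval_Const rhom_const_fract)

lemma theta_inv_X [simp]: "theta_inv (Var 1) = 1 / X" "theta_inv (Var (Suc 0)) = 1 / X"
  by (simp_all add: theta_inv_def theta_var_def peval_Var rhom_const_fract)

lemma theta_inv_z [simp]: "theta_inv (Var 0) = to_fract (Var 0) - to_fract h"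
  by (simp add: theta_inv_def theta_var_def peval_Var rhom_const_fract)

lemma theta_inv_Var: "i \<noteq> 0 \<Longrightarrow> theta_inv (Var i) = tp (Var i)"
  by (simp add: theta_inv_def tp_Var peval_Var rhom_const_fract)

text \<open>\<open>tp\<close> and \<open>theta_inv\<close> do not act on fractions, so that
  \<open>theta_inv\<close> undoes \<open>tp\<close> is expressed after clearing denominators. The
  power of x_1 reappears in the second equation because x_1 is inverted.\<close>

definition inverted :: "nat \<Rightarrow> 'k mpoly \<Rightarrow> 'k mpoly \<Rightarrow> bool" where
  "inverted K p p' \<longleftrightarrow> X ^ K * tp p = to_fract p' \<and> X ^ K * theta_inv p' = to_fract p"

lemma inverted_shift: "inverted K p p' \<Longrightarrow> inverted (K + j) p (Var 1 ^ j * p')"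
  by (simp add: inverted_def power_add mult_ac power_divide)

lemma inverted_add:
  assumes "inverted K p p'" "inverted L q q'"
  shows "inverted (K + L) (p + q) (Var 1 ^ L * p' + Var 1 ^ K * q')"
  using inverted_shift[OF assms(1), of L] inverted_shift[OF assms(2), of K]
  by (simp add: inverted_def distrib_left add.commute)

lemma inverted_mult:
  assumes "inverted K p p'" "inverted L q q'"
  shows "inverted (K + L) (p * q) (p' * q')"
  using assms by (auto simp: inverted_def power_add) (metis (no_types) mult.assoc mult.left_commute)+

lemma inverted_Const: "inverted 0 (Const c) (Const c)"
  by (simp add: inverted_def)

lemma inverted_X: "inverted 1 (Var 1) 1"
  by (simp add: inverted_def)

lemma X_powi_shift: obtains K e where "X ^ K * X powi d = X ^ e"
proof
  show "X ^ nat \<bar>d\<bar> * X powi d = X ^ nat (\<bar>d\<bar> + d)"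
    by (subst (1 2) power_int_of_nat[symmetric], subst power_int_add[symmetric]) auto
qed

lemma inverted_Var: 
  assumes "i > 0"
  shows "\<exists>K. \<exists>p'\<in>polys_in {1, i}. inverted K (Var i) p'"
proof (cases "i = 1")
  case True
  then show ?thesis using inverted_X one_in_polys by blast
next
  case False
  obtain d where d: "tp (Var i) = X powi d * to_fract (Var i)"
    using tp_Var_pos[OF assms] False by auto
  obtain K e where e: "X ^ K * X powi d = X ^ e"
    by (rule X_powi_shift)
  have 1: "X ^ K * (X powi d * v) = X ^ e * v" for v
    using e by (simp add: mult.assoc[symmetric])
  have 2: "X ^ K * (inverse X ^ e * (X powi d * v)) = v" for v
  proof -
    have "X ^ K * (inverse X ^ e * (X powi d * v)) = inverse X ^ e * (X ^ K * (X powi d * v))"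
      by (rule mult.left_commute)
    also have "\<dots> = inverse X ^ e * X ^ e * v"
      by (simp only: 1 mult.assoc)
    also have "\<dots> = v"
      by (simp flip: power_mult_distrib)
    finally show ?thesis .
  qed
  have "inverted K (Var i) (Var 1 ^ e * Var i)"
    using assms by (simp add: inverted_def theta_inv_Var d 1 2 divide_inverse flip: One_nat_def)
  moreover have "Var 1 ^ e * Var i \<in> (polys_in {1, i} :: 'k mpoly set)"
    by (induction e) (auto simp: mult.assoc intro: mult_in_polys Var_in_polys)
  ultimately show ?thesis by blast
qed

lemma inverted_in_polys: 
  assumes "p \<in> polys_in V" "\<And>i. i \<in> V \<Longrightarrow> \<exists>K p'. inverted K (Var i) p'"
  shows "\<exists>K p'. inverted K p p'"
  using assms(1)
proof (induction rule: mpoly_induct)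
  case (Const c)
  then show ?case using inverted_Const by blast
next
  case (Var i)
  then show ?case using assms(2) by blast
next
  case (add p q)
  then show ?case using inverted_add by blast
next
  case (mult p q)
  then show ?case using inverted_mult by blast
qed

lemma inverted_z: "\<exists>K p'. inverted K (Var 0) p'"
proof -
  obtain K h' where h': "inverted K h h'"
    using inverted_in_polys[OF h_in] inverted_X by auto
  \<comment> \<open>Under the inverse, the summand \<open>h'\<close> contributes h, which cancels
    the -h in the image of z.\<close>
  have "inverted K (Var 0) (Var 1 ^ K * Var 0 + h')"
    using h' by (simp add: inverted_def tp_z distrib_left power_divide)
  then show ?thesis by blast
qed

lemma inverted_ex: "\<exists>K p'. inverted K p p'"
proof (rule inverted_in_polys[of p UNIV])
  show "\<exists>K p'. inverted K (Var i) p'" for i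
    using inverted_z inverted_Var[of i] by (cases "i = 0") auto
qed simp

text \<open>If \<open>tp p\<close> vanishes, so does the numerator \<open>p'\<close>, and
  \<open>p\<close> is recovered from \<open>p'\<close>. This injectivity makes the extension to
  fractions well defined.\<close>

lemma tp_eq_0_iff [simp]: "tp p = 0 \<longleftrightarrow> p = 0"
  using inverted_ex[of p] by (auto simp: inverted_def)

abbreviation "Th \<equiv> theta n t h"

lemma Th_divide: 
  assumes "b \<noteq> 0"
  shows "Th (to_fract a / to_fract b) = tp a / tp b"
  unfolding theta_def
proof (rule the_equality)
  show "\<exists>a' b'. b' \<noteq> 0 \<and> to_fract a / to_fract b = to_fract a' / to_fract b' \<and> tp a / tp b = tp a' / tp b'"
    by (intro exI[of _ a] exI[of _ b] conjI assms refl)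
next
  fix r assume "\<exists>a' b'. b' \<noteq> 0 \<and> to_fract a / to_fract b = to_fract a' / to_fract b' \<and> r = tp a' / tp b'"
  then obtain a' b' where *: "b' \<noteq> 0" "to_fract a / to_fract b = to_fract a' / to_fract b'" "r = tp a' / tp b'"
    by blast
  have "a * b' = a' * b"
    using *(1,2) assms by (simp add: frac_eq_eq flip: to_fract_mult)
  then have "tp a * tp b' = tp a' * tp b"
    by (metis tp.mult)
  then show "r = tp a / tp b"
    using * assms by (simp add: frac_eq_eq)
qed

lemma Th_to_fract [simp]: "Th (to_fract a) = tp a"
  using Th_divide[of 1 a] by simp

lemma fract_cases: obtains a b where "b \<noteq> 0" "(q :: 'k mpoly fract) = to_fract a / to_fract b"
  by (cases q) (auto simp: Fract_conv_to_fract)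

sublocale Th: rhom Th
proof
  show "Th 1 = 1"
    using Th_to_fract[of 1] by (simp del: Th_to_fract)
  fix p q :: "'k mpoly fract"
  obtain a b where p: "b \<noteq> 0" "p = to_fract a / to_fract b" by (rule fract_cases)
  obtain c d where q: "d \<noteq> 0" "q = to_fract c / to_fract d" by (rule fract_cases)
  have "p + q = to_fract (a * d + c * b) / to_fract (b * d)"
    using p q by (simp add: add_frac_eq)
  then show "Th (p + q) = Th p + Th q"
    using p q by (simp add: Th_divide add_frac_eq del: to_fract_mult to_fract_add)
  have "p * q = to_fract (a * c) / to_fract (b * d)"
    using p q by simp
  then show "Th (p * q) = Th p * Th q"
    using p q by (simp add: Th_divide del: to_fract_mult)
qed

lemma Th_eq_0_iff [simp]: "Th p = 0 \<longleftrightarrow> p = 0"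
proof -
  obtain a b where p: "b \<noteq> 0" "p = to_fract a / to_fract b" by (rule fract_cases)
  then show ?thesis by (simp add: Th_divide)
qed

lemma Th_eq_iff [simp]: "Th p = Th q \<longleftrightarrow> p = q"
  using Th_eq_0_iff[of "p - q"] by (simp del: Th_eq_0_iff)

lemma Th_div [simp]: "Th (p / q) = Th p / Th q"
proof (cases "q = 0")
  case False
  then have "Th (p / q) * Th q = Th p" by (simp flip: Th.mult)
  then show ?thesis using False by (simp add: field_simps)
qed simp

end

section \<open>Subrings and localization\<close>

lemma subring_one: "is_subring B \<Longrightarrow> 1 \<in> B"
  and subring_diff: "is_subring B \<Longrightarrow> a \<in> B \<Longrightarrow> b \<in> B \<Longrightarrow> a - b \<in> B"
  and subring_mult: "is_subring B \<Longrightarrow> a \<in> B \<Longrightarrow> b \<in> B \<Longrightarrow> a * b \<in> B"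
  by (auto simp: is_subring_def)

lemma subring_zero: "is_subring B \<Longrightarrow> 0 \<in> B"
  using subring_diff[of B 1 1] subring_one[of B] by simp

lemma subring_uminus: "is_subring B \<Longrightarrow> a \<in> B \<Longrightarrow> - a \<in> B"
  using subring_diff[of B 0 a] subring_zero[of B] by simp

lemma subring_add: "is_subring B \<Longrightarrow> a \<in> B \<Longrightarrow> b \<in> B \<Longrightarrow> a + b \<in> B"
  using subring_diff[of B a "- b"] subring_uminus[of B b] by simp

lemma subring_sum: "is_subring B \<Longrightarrow> (\<And>x. x \<in> A \<Longrightarrow> f x \<in> B) \<Longrightarrow> sum f A \<in> B"
  by (induction A rule: infinite_finite_induct) (auto intro: subring_zero subring_add)

lemma subring_power: "is_subring B \<Longrightarrow> a \<in> B \<Longrightarrow> a ^ k \<in> B"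
  by (induction k) (auto intro: subring_one subring_mult)

lemma subring_of_nat: "is_subring B \<Longrightarrow> of_nat k \<in> B"
  by (induction k) (auto intro: subring_zero subring_one subring_add)

lemmas subring_intros = subring_one subring_zero subring_diff subring_mult subring_uminus subring_add
  subring_sum subring_power subring_of_nat

lemma subring_image:
  assumes "rhom \<phi>" and B: "is_subring B"
  shows "is_subring (\<phi> ` B)"
proof -
  interpret rhom \<phi> by fact
  show ?thesis
    unfolding is_subring_def
  proof (intro conjI ballI)
    show "1 \<in> \<phi> ` B"
      using subring_one[OF B] by (metis image_eqI one)
    fix a b assume "a \<in> \<phi> ` B" "b \<in> \<phi> ` B"
    then obtain a' b' where "a = \<phi> a'" "b = \<phi> b'" "a' \<in> B" "b' \<in> B"
      by blast
    then show "a - b \<in> \<phi> ` B" "a * b \<in> \<phi> ` B"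
      using subring_diff[OF B, of a' b'] subring_mult[OF B, of a' b'] by (simp_all flip: diff mult)
  qed
qed

lemma subring_range: "rhom \<phi> \<Longrightarrow> is_subring (range \<phi>)"
  by (rule subring_image) (auto simp: is_subring_def)

lemma subfield_subring: "is_subfield L \<Longrightarrow> is_subring L"
  by (simp add: is_subfield_def)

lemma subfield_divide: "is_subfield L \<Longrightarrow> a \<in> L \<Longrightarrow> b \<in> L \<Longrightarrow> a / b \<in> L"
  by (simp add: is_subfield_def divide_inverse subring_mult)

lemma subfield_quot_field:
  assumes B: "is_subring B"
  shows "is_subfield (quot_field B)"
  unfolding is_subfield_def is_subring_def
proof (intro conjI ballI)
  show "1 \<in> quot_field B"
    unfolding quot_field_def using subring_one[OF B] by (force intro: exI[of _ 1])
  fix x y assume "x \<in> quot_field B" "y \<in> quot_field B"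
  then obtain a b c d where *: "x = a / b" "y = c / d" "a \<in> B" "b \<in> B" "c \<in> B" "d \<in> B" "b \<noteq> 0" "d \<noteq> 0"
    unfolding quot_field_def by blast
  show "x - y \<in> quot_field B"
    unfolding quot_field_def mem_Collect_eq
    by (rule exI[of _ "a * d - c * b"], rule exI[of _ "b * d"]) (use * B in \<open>auto simp: diff_frac_eq intro: subring_intros\<close>)
  show "x * y \<in> quot_field B"
    unfolding quot_field_def mem_Collect_eq
    by (rule exI[of _ "a * c"], rule exI[of _ "b * d"]) (use * B in \<open>auto intro: subring_intros\<close>)
next
  fix x assume "x \<in> quot_field B"
  then obtain a b where *: "x = a / b" "a \<in> B" "b \<in> B" "b \<noteq> 0"
    unfolding quot_field_def by blast
  show "inverse x \<in> quot_field B"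
  proof (cases "a = 0")
    case True
    then show ?thesis
      using * subring_one[OF B] subring_zero[OF B] unfolding quot_field_def by (force intro: exI[of _ 0] exI[of _ 1])
  next
    case False
    then show ?thesis
      using * unfolding quot_field_def by force
  qed
qed

lemma quot_field_mono: "B \<subseteq> C \<Longrightarrow> quot_field B \<subseteq> quot_field C"
  unfolding quot_field_def by blast

lemma subset_quot_field: "is_subring B \<Longrightarrow> B \<subseteq> quot_field B"
  unfolding quot_field_def using subring_one[of B] by force

section \<open>Polynomial expressions over a subring\<close>

definition polys_over :: "'a::comm_ring_1 set \<Rightarrow> 'a poly set" where
  "polys_over B = {Q. \<forall>i. coeff Q i \<in> B}"

definition poly_values :: "'a::comm_ring_1 set \<Rightarrow> 'a \<Rightarrow> 'a set" where
  "poly_values B y = (\<lambda>Q. poly Q y) ` polys_over B"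

lemma polys_over_mono: "B \<subseteq> C \<Longrightarrow> polys_over B \<subseteq> polys_over C"
  by (auto simp: polys_over_def)

lemma subring_polys_over: "is_subring B \<Longrightarrow> is_subring (polys_over B)"
  unfolding is_subring_def[of "polys_over B"]
  by (auto simp: polys_over_def coeff_mult coeff_1 intro: subring_intros)

lemma const_polys_over: "is_subring B \<Longrightarrow> b \<in> B \<Longrightarrow> [:b:] \<in> polys_over B"
  by (auto simp: polys_over_def coeff_pCons split: nat.split intro: subring_intros)

lemma rhom_poly_eval: "rhom (\<lambda>Q. poly Q y)"
  by unfold_locales simp_all

lemma subring_poly_values: "is_subring B \<Longrightarrow> is_subring (poly_values B y)"
  unfolding poly_values_def by (intro subring_image rhom_poly_eval subring_polys_over)

lemma subset_poly_values: "is_subring B \<Longrightarrow> B \<subseteq> poly_values B y"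
  unfolding poly_values_def using const_polys_over[of B] by force

lemma self_in_poly_values: "is_subring B \<Longrightarrow> y \<in> poly_values B y"
  unfolding poly_values_def
  by (rule image_eqI[of _ _ "[:0, 1:]"]) (auto simp: polys_over_def coeff_pCons split: nat.split intro: subring_intros)

lemma poly_values_subset: "is_subring C \<Longrightarrow> B \<subseteq> C \<Longrightarrow> y \<in> C \<Longrightarrow> poly_values B y \<subseteq> C"
  unfolding poly_values_def polys_over_def
  by (auto simp: poly_altdef intro!: subring_intros)

lemma is_subring_hull: "is_subring (is_subring hull S)"
  by (rule hull_in) (auto simp: is_subring_def)

lemma is_subfield_hull: "is_subfield (is_subfield hull S)"
  by (rule hull_in) (auto simp: is_subfield_def is_subring_def)

lemma ring_adjoin_eq: "is_subring B \<Longrightarrow> ring_adjoin B {y} = poly_values B y"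
  unfolding ring_adjoin_def
proof
  assume B: "is_subring B"
  show "is_subring hull (B \<union> {y}) \<subseteq> poly_values B y"
    by (rule hull_minimal) (use B subset_poly_values self_in_poly_values subring_poly_values in auto)
  show "poly_values B y \<subseteq> is_subring hull (B \<union> {y})"
    by (rule poly_values_subset[OF is_subring_hull]) (use hull_subset[of "B \<union> {y}" is_subring] in auto)
qed

lemma lookup_mult_single: 
  "Poly_Mapping.lookup (p * Poly_Mapping.single s (1::'k::comm_ring_1)) (m + s) = Poly_Mapping.lookup (p :: 'k mpoly) m"
proof -
  have "p * Poly_Mapping.single s 1 = (\<Sum>k\<in>Poly_Mapping.keys p. Poly_Mapping.single (k + s) (Poly_Mapping.lookup p k))"
    by (subst poly_mapping_sum_single[of p]) (simp add: sum_distrib_right mult_single)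
  then show ?thesis
    by (simp add: lookup_sum lookup_single when_def in_keys_iff)
qed

lemma lookup_mult_Var_power: 
  "Poly_Mapping.lookup (p * Var i ^ k) (m + Poly_Mapping.single i k) = Poly_Mapping.lookup (p :: 'k::comm_ring_1 mpoly) m"
  by (simp add: Var_power lookup_mult_single)

lemma keys_mult_Var_power: 
  "m \<in> Poly_Mapping.keys (p * Var i ^ k) \<Longrightarrow> \<exists>m'\<in>Poly_Mapping.keys (p :: 'k::comm_ring_1 mpoly). m = m' + Poly_Mapping.single i k"
  using keys_mult[of p "Var i ^ k"] by (force simp: Var_power)

text \<open>This makes k[V, x_j] usable as a polynomial ring in x_j over k[V]. Since the
  coefficients do not involve x_j, every monomial of \<open>coeff Q i * Var j ^ i\<close> has
  exponent exactly \<open>i\<close> in x_j, so only the summand \<open>i = k\<close>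
  contributes.\<close>

lemma lookup_poly_Var:
  fixes Q :: "'k::comm_ring_1 mpoly poly"
  assumes Q: "Q \<in> polys_over (polys_in V)" "j \<notin> V" and m: "Poly_Mapping.lookup m j = 0"
  shows "Poly_Mapping.lookup (poly Q (Var j)) (m + Poly_Mapping.single j k) = Poly_Mapping.lookup (coeff Q k) m"
proof -
  have "Poly_Mapping.lookup (coeff Q i * Var j ^ i) (m + Poly_Mapping.single j k) =
      (if i = k then Poly_Mapping.lookup (coeff Q k) m else 0)" for i
  proof (cases "i = k")
    case True
    then show ?thesis by (simp add: lookup_mult_Var_power)
  next
    case False
    have "m + Poly_Mapping.single j k \<notin> Poly_Mapping.keys (coeff Q i * Var j ^ i)"
    proof
      assume "m + Poly_Mapping.single j k \<in> Poly_Mapping.keys (coeff Q i * Var j ^ i)"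
      then obtain m' where m': "m' \<in> Poly_Mapping.keys (coeff Q i)" 
        "m + Poly_Mapping.single j k = m' + Poly_Mapping.single j i"
        using keys_mult_Var_power by blast
      have "Poly_Mapping.lookup m' j = 0"
        using m'(1) Q polys_in_lookup[of "coeff Q i" V m' j] by (auto simp: polys_over_def)
      moreover have "Poly_Mapping.lookup (m + Poly_Mapping.single j k) j = Poly_Mapping.lookup (m' + Poly_Mapping.single j i) j"
        using m'(2) by simp
      ultimately show False using False m by (simp add: lookup_add)
    qed
    then show ?thesis using False by (simp add: in_keys_iff)
  qed
  then show ?thesis
    by (simp add: poly_altdef lookup_sum coeff_eq_0)
qed

lemma poly_Var_inj:
  fixes Q :: "'k::comm_ring_1 mpoly poly"
  assumes "Q \<in> polys_over (polys_in V)" "Q' \<in> polys_over (polys_in V)" "j \<notin> V" "poly Q (Var j) = poly Q' (Var j)"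
  shows "Q = Q'"
proof (rule poly_eqI, rule poly_mapping_eqI)
  fix k m
  show "Poly_Mapping.lookup (coeff Q k) m = Poly_Mapping.lookup (coeff Q' k) m"
  proof (cases "Poly_Mapping.lookup m j = 0")
    case True
    then show ?thesis using assms lookup_poly_Var by metis
  next
    case False
    then have "m \<notin> Poly_Mapping.keys (coeff Q k)" "m \<notin> Poly_Mapping.keys (coeff Q' k)"
      using assms(1-3) polys_in_lookup[of _ V m j] by (auto simp: polys_over_def)
    then show ?thesis by (simp add: in_keys_iff)
  qed
qed

lemma polys_in_insert: "(polys_in (insert j V) :: 'k::comm_ring_1 mpoly set) \<subseteq> poly_values (polys_in V) (Var j)"
proof
  fix p :: "'k mpoly" assume "p \<in> polys_in (insert j V)"
  then show "p \<in> poly_values (polys_in V) (Var j)"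
  proof (induction rule: mpoly_induct)
    case (Var i)
    then show ?case
      using self_in_poly_values[OF is_subring_polys_in, of "Var j" V] subset_poly_values[OF is_subring_polys_in, of V "Var j"] Var_in_polys[of i V]
      by auto
  next
    case (Const c)
    then show ?case
      using subset_poly_values[OF is_subring_polys_in, of V "Var j"] by auto
  qed (auto intro: subring_intros subring_poly_values is_subring_polys_in)
qed

text \<open>Long division by \<open>B\<close> never leaves L: the leading coefficient of
  \<open>Q\<close> is a quotient of two elements of L, and subtracting the leading term of
  \<open>Q\<close> leaves a quotient of smaller degree.\<close>

lemma coeffs_quotient_in_subfield:
  fixes B Q :: "'a::field poly"
  assumes L: "is_subfield L" and "B \<in> polys_over L" "B \<noteq> 0" "B * Q \<in> polys_over L"
  shows "Q \<in> polys_over L"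
  using assms(4)
proof (induction "degree Q" arbitrary: Q rule: less_induct)
  case less
  show ?case
  proof (cases "Q = 0")
    case True
    then show ?thesis using L by (auto simp: polys_over_def intro: subring_zero subfield_subring)
  next
    case False
    have lc: "lead_coeff Q \<in> L"
    proof -
      have "lead_coeff Q = coeff (B * Q) (degree B + degree Q) / lead_coeff B"
        using \<open>B \<noteq> 0\<close> by (simp add: coeff_mult_degree_sum)
      then show ?thesis
        using less.prems assms(2) L by (auto simp: polys_over_def intro: subfield_divide)
    qed
    define T where "T = monom (lead_coeff Q) (degree Q)"
    have T: "T \<in> polys_over L"
      using lc L by (auto simp: polys_over_def T_def intro: subring_zero subfield_subring)
    have S: "is_subring (polys_over L)"
      using L by (intro subring_polys_over subfield_subring)
    have "Q - T \<in> polys_over L"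
    proof (cases "Q - T = 0")
      case True
      then show ?thesis using S subring_zero by simp
    next
      case False
      then have "degree (Q - T) < degree Q"
        by (intro degree_less_if_less_eqI) (auto simp: T_def degree_diff_le degree_monom_le simp del: right_minus_eq)
      moreover have "B * (Q - T) \<in> polys_over L"
        using less.prems assms(2) T S by (simp add: right_diff_distrib subring_intros)
      ultimately show ?thesis using less.hyps by blast
    qed
    then have "(Q - T) + T \<in> polys_over L"
      using T S subring_add by blast
    then show ?thesis by simp
  qed
qed

section \<open>The localization of k[V] at x_1\<close>

context theta_subst
begin

definition loc :: "nat set \<Rightarrow> 'k mpoly fract set" where
  "loc V = {y. \<exists>K. \<exists>p\<in>polys_in V. X ^ K * y = to_fract p}"

lemma loc_shift: 
  assumes "1 \<in> V" "p \<in> polys_in V" "X ^ K * y = to_fract p"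
  shows "\<exists>p\<in>polys_in V. X ^ (K + L) * y = to_fract p"
  by (rule bexI[of _ "Var 1 ^ L * p"])
    (use assms in \<open>auto simp: power_add mult_ac intro!: mult_in_polys subring_power[OF is_subring_polys_in] Var_in_polys\<close>)

lemma subring_loc: 
  assumes V: "1 \<in> V" 
  shows "is_subring (loc V)"
  unfolding is_subring_def
proof (intro conjI ballI)
  show "1 \<in> loc V"
    unfolding loc_def by (auto intro!: exI[of _ 0] bexI[of _ 1])
  fix a b assume "a \<in> loc V" "b \<in> loc V"
  then obtain K L p q where *: "p \<in> polys_in V" "q \<in> polys_in V" "X ^ K * a = to_fract p" "X ^ L * b = to_fract q"
    unfolding loc_def by blast
  obtain p' where p': "p' \<in> polys_in V" "X ^ (K + L) * a = to_fract p'"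
    using loc_shift[OF V *(1,3)] by blast
  obtain q' where q': "q' \<in> polys_in V" "X ^ (L + K) * b = to_fract q'"
    using loc_shift[OF V *(2,4)] by blast
  have "X ^ (K + L) * (a - b) = to_fract (p' - q')"
    using p' q' by (simp add: right_diff_distrib add.commute)
  then show "a - b \<in> loc V"
    unfolding loc_def using diff_in_polys[OF p'(1) q'(1)] by blast
  have "X ^ (K + L) * (a * b) = to_fract (p * q)"
    by (simp add: *(3,4)[symmetric] power_add mult_ac)
  then show "a * b \<in> loc V"
    unfolding loc_def using mult_in_polys[OF *(1,2)] by blast
qed

lemma to_fract_in_loc: "p \<in> polys_in V \<Longrightarrow> to_fract p \<in> loc V"
  unfolding loc_def by (auto intro!: exI[of _ 0])

lemma X_powi_in_loc: "1 \<in> V \<Longrightarrow> X powi d \<in> loc V"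
  unfolding loc_def
proof (cases "d \<ge> 0")
  case True
  assume "1 \<in> V"
  then show "X powi d \<in> {y. \<exists>K. \<exists>p\<in>polys_in V. X ^ K * y = to_fract p}"
    using True by (auto simp: power_int_def intro!: exI[of _ 0] bexI[of _ "Var 1 ^ nat d"] 
      subring_power[OF is_subring_polys_in] Var_in_polys)
next
  case False
  then show "X powi d \<in> {y. \<exists>K. \<exists>p\<in>polys_in V. X ^ K * y = to_fract p}"
    by (auto simp: power_int_def power_mult_distrib[symmetric] intro!: exI[of _ "nat (- d)"] bexI[of _ 1])
qed

text \<open>The case without z comes first, because \<open>tp (Var 0)\<close> contains
  \<open>tp h\<close>.\<close>

lemma tp_pos_in_loc:
  assumes "1 \<in> V" "p \<in> polys_in (V - {0})"
  shows "tp p \<in> loc V"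
  using assms(2)
proof (induction rule: mpoly_induct)
  case (Var i)
  then obtain d where "tp (Var i) = X powi d * to_fract (if i = 1 then 1 else Var i)"
    using tp_Var_pos[of i] by auto
  moreover have "to_fract (if i = 1 then 1 else Var i) \<in> loc V"
    using Var subring_one[OF subring_loc[OF assms(1)]] by (auto intro!: to_fract_in_loc Var_in_polys)
  ultimately show ?case
    using subring_mult[OF subring_loc[OF assms(1)] X_powi_in_loc[OF assms(1)]] by metis
qed (auto intro: subring_intros subring_loc assms(1) to_fract_in_loc)

lemma tp_in_loc:
  assumes "1 \<in> V" "p \<in> polys_in V"
  shows "tp p \<in> loc V"
  using assms(2)
proof (induction rule: mpoly_induct)
  case (Var i)
  show ?case
  proof (cases "i = 0")
    case True
    have "tp h \<in> loc V"
      using h_in assms(1) polys_in_mono[of "{1}" "V - {0}"] by (intro tp_pos_in_loc) auto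
    then show ?thesis
      using True Var by (auto simp: tp_z intro!: subring_intros subring_loc assms(1) to_fract_in_loc Var_in_polys)
  next
    case False
    then show ?thesis
      using Var assms(1) by (intro tp_pos_in_loc Var_in_polys) auto
  qed
qed (auto intro: subring_intros subring_loc assms(1) to_fract_in_loc)

lemma tp_times_X_power: "X ^ (K + L) * tp (Var 1 ^ L * p) = X ^ K * tp p"
  by (simp add: power_add power_divide del: One_nat_def)

text \<open>\<theta> maps the localization onto itself: \<open>X ^ K\<close> is the image of
  1/x_1^K, so \<open>p\<close> is the image of p'/x_1^K.\<close>

lemma tp_surj_loc:
  assumes "1 \<in> V" "p \<in> polys_in V"
  shows "\<exists>K. \<exists>p'\<in>polys_in V. X ^ K * tp p' = to_fract p"
  using assms(2)
proof (induction rule: mpoly_induct)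
  case (Const c)
  then show ?case by (auto intro!: exI[of _ 0] bexI[of _ "Const c"])
next
  case (Var i)
  show ?case
  proof (cases "i = 0")
    case True
    have "h \<in> polys_in V"
      using h_in assms(1) polys_in_mono[of "{1}" V] by auto
    then show ?thesis
      using True Var by (auto simp: tp_z intro!: exI[of _ 0] bexI[of _ "Var 0 - h"] diff_in_polys Var_in_polys)
  next
    case False
    then obtain K p' where p': "p' \<in> polys_in {1, i}" "inverted K (Var i) p'"
      using inverted_Var by blast
    \<comment> \<open>Only x_1 and x_i with i nonzero occur in \<open>p'\<close>, and there both
      substitutions agree. The second half of \<open>inverted\<close> then is the claim.\<close>
    have "theta_inv p' = tp p'"
      using False by (intro rhom_eq_on_polys[OF theta_inv_rhom theta_poly_rhom p'(1)]) (auto simp: theta_inv_Var simp del: theta_inv_X)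
    then show ?thesis
      using p' Var assms(1) polys_in_mono[of "{1, i}" V] by (auto simp: inverted_def)
  qed
next
  case (add p q)
  then obtain K p' L q' where *: "p' \<in> polys_in V" "X ^ K * tp p' = to_fract p" "q' \<in> polys_in V" "X ^ L * tp q' = to_fract q"
    by blast
  have "X ^ (K + L) * tp (Var 1 ^ L * p' + Var 1 ^ K * q') = to_fract (p + q)"
    using tp_times_X_power[of K L p'] tp_times_X_power[of L K q'] *
    by (simp only: tp.add distrib_left add.commute[of L K] to_fract_add)
  then show ?case
    using * assms by (blast intro: add_in_polys mult_in_polys Var_in_polys subring_power[OF is_subring_polys_in])
next
  case (mult p q)
  then obtain K p' L q' where *: "p' \<in> polys_in V" "X ^ K * tp p' = to_fract p" "q' \<in> polys_in V" "X ^ L * tp q' = to_fract q"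
    by blast
  have "X ^ (K + L) * tp (p' * q') = to_fract (p * q)"
    by (simp add: *(2,4)[symmetric] power_add mult_ac)
  then show ?case
    using mult_in_polys[OF *(1,3)] by blast
qed

end

section \<open>The field M(z), the ring R[z] and the algebra A\<close>

locale invariant_field = theta_subst n t h for n t and h :: "'k::field_char_0 mpoly" +
  fixes M :: "'k mpoly fract set"
  assumes n: "n \<ge> 1"
    and M_subfield: "is_subfield M" and M_const: "constants \<subset> M"
    and dag1: "M \<inter> to_fract ` polys_in {1..n} = M \<inter> localize (to_fract ` polys_in {1..n}) (to_fract (Var 1))"
    and dag2: "quot_field (to_fract ` {p \<in> polys_in {1..n}. to_fract p \<in> M}) = M"
begin

abbreviation "kx \<equiv> polys_in {1..n} :: 'k mpoly set"
abbreviation "kxz \<equiv> polys_in {0..n} :: 'k mpoly set"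

definition R :: "'k mpoly set" where
  "R = {p \<in> kx. to_fract p \<in> M}"

definition Rz :: "'k mpoly set" where
  "Rz = poly_values R (Var 0)"

definition Mz :: "'k mpoly fract set" where
  "Mz = field_adjoin M {to_fract (Var 0)}"

definition A :: "'k mpoly fract set" where
  "A = Th ` Mz \<inter> to_fract ` kxz"

lemma subring_M: "is_subring M"
  using M_subfield by (rule subfield_subring)

lemma R_subset_kx: "R \<subseteq> kx"
  by (auto simp: R_def)

lemma subring_R: "is_subring R"
  using subring_M is_subring_polys_in[of "{1..n}", where 'k='k] unfolding is_subring_def[of R]
  by (auto simp: R_def intro: subring_intros)

lemma Const_in_R: "Const c \<in> R"
  using M_const by (auto simp: R_def constants_def)

lemma subring_Rz: "is_subring Rz"
  unfolding Rz_def by (intro subring_poly_values subring_R)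

lemma kx_subset_kxz: "kx \<subseteq> kxz"
  by (rule polys_in_mono) auto

lemma Var0_in_kxz: "Var 0 \<in> kxz"
  by (rule Var_in_polys) auto

lemma Var1_in_kx: "Var 1 \<in> kx"
  using n by (intro Var_in_polys) auto

lemma Rz_subset_kxz: "Rz \<subseteq> kxz"
  unfolding Rz_def
  by (rule poly_values_subset) (use R_subset_kx kx_subset_kxz is_subring_polys_in Var0_in_kxz in auto)

lemma subfield_Mz: "is_subfield Mz"
  unfolding Mz_def field_adjoin_def by (rule is_subfield_hull)

lemma M_subset_Mz: "M \<subseteq> Mz" and z_in_Mz: "to_fract (Var 0) \<in> Mz"
  unfolding Mz_def field_adjoin_def using hull_subset[of "M \<union> {to_fract (Var 0)}" is_subfield] by auto

lemma Rz_in_Mz: "p \<in> Rz \<Longrightarrow> to_fract p \<in> Mz"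
proof -
  assume "p \<in> Rz"
  then obtain Q where Q: "Q \<in> polys_over R" "p = poly Q (Var 0)"
    by (auto simp: Rz_def poly_values_def)
  have "to_fract p = (\<Sum>i\<le>degree Q. to_fract (coeff Q i) * to_fract (Var 0) ^ i)"
    by (simp add: Q(2) poly_altdef)
  moreover have "to_fract (coeff Q i) \<in> Mz" for i
    using Q(1) M_subset_Mz by (auto simp: polys_over_def R_def)
  ultimately show ?thesis
    using z_in_Mz subfield_subring[OF subfield_Mz] by (auto intro!: subring_intros)
qed

text \<open>The fractions over R[z] form a field. It contains z, and it contains M because by
  \<open>dag2\<close> every element of M is a fraction over R.\<close>

lemma Mz_quot:
  assumes "q \<in> Mz"
  obtains a b where "a \<in> Rz" "b \<in> Rz" "b \<noteq> 0" "q = to_fract a / to_fract b"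
proof -
  have S: "is_subring (to_fract ` Rz)"
    by (intro subring_image rhom_to_fract subring_Rz)
  have "R \<subseteq> Rz"
    unfolding Rz_def by (rule subset_poly_values[OF subring_R])
  then have "M \<subseteq> quot_field (to_fract ` Rz)"
    using dag2 quot_field_mono[of "to_fract ` R" "to_fract ` Rz"] unfolding R_def[symmetric] by auto
  moreover have "to_fract (Var 0) \<in> quot_field (to_fract ` Rz)"
    using subset_quot_field[OF S] self_in_poly_values[OF subring_R, of "Var 0"] unfolding Rz_def by blast
  ultimately have "Mz \<subseteq> quot_field (to_fract ` Rz)"
    unfolding Mz_def field_adjoin_def by (intro hull_minimal subfield_quot_field S) auto
  then show thesis
    using assms that unfolding quot_field_def by auto
qed

text \<open>Read a x_1^K = b c as an identity between polynomials in z. Division by b over M shows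
  that the coefficients of c/x_1^K lie in M; by \<open>dag1\<close> they then lie in k[x], hence in
  R.\<close>

lemma Mz_inter_loc:
  assumes q: "q \<in> Mz" "q \<in> loc {0..n}"
  shows "\<exists>p\<in>Rz. q = to_fract p"
proof -
  obtain a b where ab: "a \<in> Rz" "b \<in> Rz" "b \<noteq> 0" "q = to_fract a / to_fract b"
    using Mz_quot[OF q(1)] .
  obtain K c where c: "c \<in> kxz" "X ^ K * q = to_fract c"
    using q(2) unfolding loc_def by blast
  obtain P where P: "P \<in> polys_over R" "a = poly P (Var 0)"
    using ab(1) by (auto simp: Rz_def poly_values_def)
  obtain B where B: "B \<in> polys_over R" "b = poly B (Var 0)"
    using ab(2) by (auto simp: Rz_def poly_values_def)
  have "{0..n} = insert 0 {1..n}" by auto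
  then obtain C where C: "C \<in> polys_over kx" "c = poly C (Var 0)"
    using c(1) polys_in_insert[of 0 "{1..n}", where 'k='k] by (auto simp: poly_values_def)
  have over: "polys_over R \<subseteq> polys_over kx"
    by (rule polys_over_mono[OF R_subset_kx])
  have "to_fract (a * Var 1 ^ K) = to_fract (b * c)"
  proof -
    have "to_fract a = to_fract b * q"
      using ab(3,4) by simp
    then show ?thesis by (simp add: c(2)[symmetric] mult_ac)
  qed
  then have "poly (P * [:Var 1 ^ K:]) (Var 0) = poly (B * C) (Var 0)"
    using P B C by (simp add: mult.commute del: to_fract_mult)
  moreover have "[:Var 1 ^ K:] \<in> polys_over kx"
    by (intro const_polys_over subring_power is_subring_polys_in Var1_in_kx)
  \<comment> \<open>The coefficients are free of z, so equal values at z mean equal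
    polynomials.\<close>
  ultimately have eq: "P * [:Var 1 ^ K:] = B * C"
    using P B C over by (intro poly_Var_inj[of _ "{1..n}"] subring_mult is_subring_polys_in subring_polys_over) auto
  \<comment> \<open>\<open>D\<close> is q as a polynomial in z, with coefficients in the
    localization of k[x] at x_1.\<close>
  define D where "D = smult (inverse (X ^ K)) (map_poly to_fract C)"
  have "map_poly to_fract P = map_poly to_fract B * D"
  proof -
    have "smult (X ^ K) (map_poly to_fract P) = map_poly to_fract (P * [:Var 1 ^ K:])"
      by (simp add: mult.commute)
    also have "\<dots> = map_poly to_fract B * map_poly to_fract C"
      by (simp only: eq fract_poly_mult)
    finally have "smult (inverse (X ^ K)) (smult (X ^ K) (map_poly to_fract P)) = map_poly to_fract B * D"
      by (simp add: D_def)
    then show ?thesis by simp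
  qed
  moreover have "map_poly to_fract P \<in> polys_over M" "map_poly to_fract B \<in> polys_over M"
    using P(1) B(1) by (auto simp: polys_over_def R_def coeff_map_poly)
  moreover have "map_poly to_fract B \<noteq> 0"
    using ab(3) B(2) by auto
  ultimately have D: "D \<in> polys_over M"
    using coeffs_quotient_in_subfield[OF M_subfield] by metis
  have "\<exists>r\<in>R. coeff D i = to_fract r" for i
  proof -
    have "coeff D i \<in> localize (to_fract ` kx) X"
    proof -
      have "to_fract (coeff C i) \<in> to_fract ` kx"
        using C(1) by (auto simp: polys_over_def)
      moreover have "coeff D i = to_fract (coeff C i) * (1 / X) ^ K"
        by (simp add: D_def coeff_map_poly divide_inverse power_inverse)
      ultimately show ?thesis
        unfolding localize_def ring_adjoin_def
        using hull_subset[of "to_fract ` kx \<union> {1 / X}" is_subring]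
        by (auto intro!: subring_mult subring_power is_subring_hull)
    qed
    then have "coeff D i \<in> M \<inter> to_fract ` kx"
      using D by (subst dag1) (auto simp: polys_over_def)
    then show ?thesis by (auto simp: R_def)
  qed
  then obtain r where r: "\<And>i. r i \<in> R" "\<And>i. coeff D i = to_fract (r i)"
    by metis
  have "q = inverse (X ^ K) * to_fract c"
    using c(2) by (simp add: field_simps del: One_nat_def)
  also have "\<dots> = (\<Sum>i\<le>degree C. coeff D i * to_fract (Var 0) ^ i)"
    by (simp add: C(2) poly_altdef D_def coeff_map_poly sum_distrib_left mult.assoc)
  also have "\<dots> = to_fract (\<Sum>i\<le>degree C. r i * Var 0 ^ i)"
    by (simp add: r(2))
  finally have "q = to_fract (\<Sum>i\<le>degree C. r i * Var 0 ^ i)" .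
  moreover have "(\<Sum>i\<le>degree C. r i * Var 0 ^ i) \<in> Rz"
    using r(1) subset_poly_values[OF subring_R, of "Var 0"] self_in_poly_values[OF subring_R, of "Var 0"]
    by (intro subring_intros subring_Rz) (auto simp: Rz_def)
  ultimately show ?thesis by blast
qed

lemma A_memberE:
  assumes "a \<in> A"
  obtains p where "p \<in> Rz" "a = tp p"
proof -
  obtain q c where q: "a = Th q" "q \<in> Mz" and c: "c \<in> kxz" "a = to_fract c"
    using assms unfolding A_def by blast
  obtain K p' where p': "p' \<in> kxz" "X ^ K * tp p' = to_fract c"
    using tp_surj_loc[OF _ c(1)] n by auto
  \<comment> \<open>\<theta> sends 1/x_1^K to x_1^K, so this fraction has the same image as q;
    injectivity identifies the two.\<close>
  have "Th (to_fract p' / X ^ K) = Th q"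
    using p' q c by (simp add: power_divide mult.commute)
  then have "q = to_fract p' / X ^ K"
    by (simp del: Th_div)
  then have "q \<in> loc {0..n}"
    unfolding loc_def using p'(1) by (auto intro!: exI[of _ K])
  from Mz_inter_loc[OF q(2) this] show thesis
    using that q(1) by auto
qed

lemma A_memberI: "p \<in> Rz \<Longrightarrow> tp p \<in> to_fract ` kxz \<Longrightarrow> tp p \<in> A"
  unfolding A_def using Rz_in_Mz[of p] by (metis IntI Th_to_fract image_eqI)

end

section \<open>Monomials of elements of the algebra\<close>

text \<open>\<open>eps\<close> sends z to 0 as well. This variant keeps z and agrees with
  \<open>eps\<close> on polynomials without z.\<close>

definition epsz :: "'k::field mpoly \<Rightarrow> 'k mpoly" where
  "epsz = peval Const (\<lambda>i. if i \<le> 1 then Var i else 0)"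

interpretation epsz: rhom "epsz :: 'k::field mpoly \<Rightarrow> _"
  unfolding epsz_def by (rule rhom_peval[OF rhom_Const])

lemma epsz_Const [simp]: "epsz (Const c) = Const c"
  by (simp add: epsz_def peval_Const rhom_Const)

lemma epsz_Var: "epsz (Var i) = (if i \<le> 1 then Var i else 0)"
  by (simp add: epsz_def peval_Var rhom_Const)

lemma eps_eq_epsz: "p \<in> polys_in V \<Longrightarrow> 0 \<notin> V \<Longrightarrow> eps p = epsz p"
  unfolding eps_def epsz_def by (rule peval_cong) (auto simp: le_Suc_eq intro!: gr0I)

lemma epsz_in_polys_1: "p \<in> polys_in (- {0}) \<Longrightarrow> epsz p \<in> polys_in {1}"
  by (induction rule: mpoly_induct) (auto simp: epsz_Var le_Suc_eq intro: add_in_polys mult_in_polys Var_in_polys)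

lemma epsz_ident: "p \<in> polys_in {0, 1} \<Longrightarrow> epsz p = p"
  by (induction rule: mpoly_induct) (auto simp: epsz_Var)

text \<open>Monomials divisible by a variable of index at least 2 are sent to 0 and all others are
  fixed.\<close>

lemma lookup_epsz:
  fixes p :: "'k::field mpoly"
  assumes "Poly_Mapping.keys m \<subseteq> {0, 1}"
  shows "Poly_Mapping.lookup (epsz p) m = Poly_Mapping.lookup p m"
proof -
  let ?s = "\<lambda>i. if i \<le> 1 then Var i else (0 :: 'k mpoly)"
  have 1: "mon_val ?s k = Poly_Mapping.single k 1" if "Poly_Mapping.keys k \<subseteq> {0, 1}" for k
  proof -
    have "mon_val ?s k = mon_val Var k"
      unfolding mon_val_def by (rule prod.cong) (use that in auto)
    then show ?thesis by (simp add: single_eq_mon_val)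
  qed
  have 2: "mon_val ?s k = 0" if nk: "\<not> Poly_Mapping.keys k \<subseteq> {0, 1}" for k
  proof -
    obtain i where "i \<in> Poly_Mapping.keys k" "i \<noteq> 0" "i \<noteq> 1"
      using nk by auto
    then show ?thesis
      unfolding mon_val_def by (intro prod_zero) (auto simp: in_keys_iff intro!: bexI[of _ i])
  qed
  have "Poly_Mapping.lookup (Const (Poly_Mapping.lookup p k) * mon_val ?s k) m = (if m = k then Poly_Mapping.lookup p m else 0)" for k
    using assms 1[of k] 2[of k] by (cases "Poly_Mapping.keys k \<subseteq> {0, 1}") (auto simp: lookup_Const_mult lookup_single when_def)
  then show ?thesis
    by (simp add: epsz_def peval_mon_val lookup_sum in_keys_iff)
qed

lemma polys_in_empty: "polys_in {} = range (Const :: 'k::comm_ring_1 \<Rightarrow> _)"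
proof
  show "polys_in {} \<subseteq> range (Const :: 'k \<Rightarrow> _)"
  proof
    fix p :: "'k mpoly" assume "p \<in> polys_in {}"
    then have "Poly_Mapping.keys p \<subseteq> {0}"
      by (auto simp: polys_in_iff)
    then have "p = Const (Poly_Mapping.lookup p 0)"
      by (intro poly_mapping_eqI) (auto simp: Const_def lookup_single when_def in_keys_iff)
    then show "p \<in> range Const" by blast
  qed
qed auto

lemma subring_range_Const: "is_subring (range (Const :: 'k::comm_ring_1 \<Rightarrow> _))"
  by (rule subring_range[OF rhom_Const])

text \<open>If \<open>Q(z + h)\<close> has constant coefficients, so have its derivatives; the last nonconstant one
  is linear and exhibits \<open>h\<close> as an element of \<open>B\<close>.\<close>

lemma constant_if_shift_constant:
  fixes h :: "'k::field_char_0 mpoly"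
  assumes B: "is_subring B" "range Const \<subseteq> B" "h \<notin> B"
    and "Q \<in> polys_over B" "pcompose Q [:h, 1:] \<in> polys_over (range Const)"
  shows "\<exists>c. Q = [:Const c:]"
  using assms(4,5)
proof (induction "degree Q" arbitrary: Q rule: less_induct)
  case less
  note K = subring_range_Const[where 'k='k]
  show ?case
  proof (cases "degree Q = 0")
    case True
    then obtain q where "Q = [:q:]" by (rule degree_eq_zeroE)
    then show ?thesis using less.prems(2)
      by (auto simp: polys_over_def dest!: spec[of _ 0])
  next
    case False
    have "pcompose (pderiv Q) [:h, 1:] = pderiv (pcompose Q [:h, 1:])"
      by (simp add: pderiv_pcompose pderiv_pCons)
    moreover have "pderiv (pcompose Q [:h, 1:]) \<in> polys_over (range Const)"
      unfolding polys_over_def mem_Collect_eq coeff_pderiv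
    proof
      fix i
      show "of_nat (Suc i) * coeff (pcompose Q [:h, 1:]) (Suc i) \<in> range Const"
        by (intro subring_mult subring_of_nat K) (use less.prems(2) in \<open>auto simp: polys_over_def\<close>)
    qed
    moreover have "pderiv Q \<in> polys_over B"
      unfolding polys_over_def mem_Collect_eq coeff_pderiv
    proof
      fix i
      show "of_nat (Suc i) * coeff Q (Suc i) \<in> B"
        by (intro subring_mult subring_of_nat B) (use less.prems(1) in \<open>auto simp: polys_over_def\<close>)
    qed
    moreover have "degree (pderiv Q) < degree Q"
      using False by (simp add: degree_pderiv)
    ultimately obtain c where c: "pderiv Q = [:Const c:]"
      using less.hyps[of "pderiv Q"] by metis
    have "degree Q = 1"
      using degree_pderiv[of Q] False c by simp
    obtain q0 Q' where Q': "Q = pCons q0 Q'"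
      by (cases Q)
    have "Q' \<noteq> 0" "degree Q' = 0"
      using \<open>degree Q = 1\<close> by (auto simp: Q' split: if_splits)
    then obtain q1 where Q: "Q = [:q0, q1:]" "q1 \<noteq> 0"
      by (auto simp: Q' elim: degree_eq_zeroE)
    have q1: "q1 = Const c"
      using c by (simp add: Q pderiv_pCons)
    have "q0 + h * q1 \<in> range Const"
      using less.prems(2) by (auto simp: Q pcompose_pCons polys_over_def mult.commute dest!: spec[of _ 0])
    then obtain d where d: "q0 + h * Const c = Const d"
      by (auto simp: q1)
    have "h = (h * Const c) * Const (1 / c)"
      using Q(2) by (simp add: mult.assoc q1 flip: Const.mult)
    also have "h * Const c = Const d - q0"
      by (simp flip: d)
    finally have "h = (Const d - q0) * Const (1 / c)" .
    moreover have "q0 \<in> B"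
      using less.prems(1) by (auto simp: Q polys_over_def dest!: spec[of _ 0])
    ultimately have "h \<in> B"
      using B(1,2) by (metis range_subsetD subring_diff subring_mult)
    with B(3) show ?thesis by contradiction
  qed
qed

section \<open>\<theta> modulo the variables of index at least 2\<close>

context theta_subst
begin

text \<open>\<open>epsz\<close> commutes with \<theta>, because \<theta> multiplies each variable of
  index at least 2 by a power of x_1 and h involves only x_1. As \<open>epsz\<close> does not act on
  fractions, both sides are first multiplied by a common \<open>X ^ K\<close>.\<close>

lemma epsz_tp_denominator: "\<exists>K p'. X ^ K * tp p = to_fract p' \<and> X ^ K * tp (epsz p) = to_fract (epsz p')"
proof -
  define rel where "rel K p p' \<longleftrightarrow> X ^ K * tp p = to_fract p' \<and> X ^ K * tp (epsz p) = to_fract (epsz p')" for K p p'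
  have shift: "rel (K + j) p (Var 1 ^ j * p')" if "rel K p p'" for K j p p'
    using that by (simp add: rel_def power_add mult_ac epsz_Var)
  have radd: "rel (K + L) (p + q) (Var 1 ^ L * p' + Var 1 ^ K * q')" if "rel K p p'" "rel L q q'" for K L p q p' q'
    using shift[OF that(1), of L] shift[OF that(2), of K] by (simp add: rel_def distrib_left add.commute)
  have rmult: "rel (K + L) (p * q) (p' * q')" if "rel K p p'" "rel L q q'" for K L p q p' q'
    using that by (auto simp: rel_def power_add mult_ac simp flip: to_fract_mult)
  have rC: "rel 0 (Const c) (Const c)" for c
    by (simp add: rel_def)
  have rX: "rel 1 (Var 1) 1"
    by (simp add: rel_def epsz_Var)
  have pos: "\<exists>K p'. rel K p p'" if "p \<in> polys_in (- {0})" for p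
    using that
  proof (induction rule: mpoly_induct)
    case (Var i)
    show ?case
    proof (cases "i = 1")
      case True
      then show ?thesis using rX by blast
    next
      case False
      obtain d where d: "tp (Var i) = X powi d * to_fract (Var i)"
        using tp_Var_pos[of i] Var False by auto
      obtain K e where e: "X ^ K * X powi d = X ^ e"
        by (rule X_powi_shift)
      have "rel K (Var i) (Var 1 ^ e * Var i)"
        using Var False e by (simp add: rel_def epsz_Var d mult.assoc[symmetric])
      then show ?thesis by blast
    qed
  qed (use radd rmult rC in blast)+
  have "h \<in> polys_in (- {0})"
    using h_in polys_in_mono[of "{1}" "- {0}"] by auto
  then obtain K h' where h': "rel K h h'"
    using pos by blast
  have "epsz h = h"
    using h_in polys_in_mono[of "{1}" "{0, 1}"] by (intro epsz_ident) auto
  moreover from this have "epsz h' = h'"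
    using h' unfolding rel_def by (metis to_fract_eq_iff)
  ultimately have z: "rel K (Var 0) (Var 1 ^ K * Var 0 + h')"
    using h' by (simp add: rel_def epsz_Var tp_z distrib_left)
  have "p \<in> polys_in UNIV" by simp
  then have "\<exists>K p'. rel K p p'"
  proof (induction rule: mpoly_induct)
    case (Var i)
    show ?case
      by (cases "i = 0") (use z pos[of "Var i"] Var_in_polys[of i "- {0}"] in auto)
  qed (use radd rmult rC in blast)+
  then show ?thesis by (simp add: rel_def)
qed

lemma tp_epsz:
  assumes "tp p = to_fract c"
  shows "tp (epsz p) = to_fract (epsz c)"
proof -
  obtain K p' where *: "X ^ K * tp p = to_fract p'" "X ^ K * tp (epsz p) = to_fract (epsz p')"
    using epsz_tp_denominator by blast
  have "to_fract p' = to_fract (Var 1 ^ K * c)"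
    using assms * by simp
  then have "p' = Var 1 ^ K * c"
    by (simp only: to_fract_eq_iff)
  then have "X ^ K * tp (epsz p) = X ^ K * to_fract (epsz c)"
    using * by (simp add: epsz_Var)
  then show ?thesis by simp
qed

lemma tp_eq_iff: "tp p = tp q \<longleftrightarrow> p = q"
  using Th_eq_iff[of "to_fract p" "to_fract q"] by (simp del: Th_eq_iff)

text \<open>On k[x_1,z], applying \<theta> means replacing z by z + h and then applying this
  substitution.\<close>

definition invert_X :: "'k mpoly \<Rightarrow> 'k mpoly fract" where
  "invert_X = peval (\<lambda>c. to_fract (Const c)) (\<lambda>i. if i = 1 then 1 / X else to_fract (Var i))"

sublocale invert_X: rhom invert_X
  unfolding invert_X_def by (rule rhom_peval[OF rhom_const_fract])

lemma invert_X_Var: "invert_X (Var i) = (if i = 1 then 1 / X else to_fract (Var i))"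
  by (simp add: invert_X_def peval_Var rhom_const_fract)

lemma invert_X_Const: "invert_X (Const c) = to_fract (Const c)"
  by (simp add: invert_X_def peval_Const rhom_const_fract)

lemma tp_eq_invert_X: "p \<in> polys_in {1} \<Longrightarrow> tp p = invert_X p"
  by (rule rhom_eq_on_polys[OF theta_poly_rhom invert_X.rhom_axioms]) (auto simp: invert_X_Const invert_X_Var)

lemma invert_X_id: "p \<in> polys_in (- {1}) \<Longrightarrow> invert_X p = to_fract p"
  by (rule rhom_eq_on_polys[OF invert_X.rhom_axioms rhom_to_fract]) (auto simp: invert_X_Const invert_X_Var)

text \<open>Write p as a polynomial Q in x_1. Multiplying Q(1/x_1) by x_1 to the power deg Q gives
  the reflected polynomial, whose constant term is the leading coefficient of Q. If Q(1/x_1) is a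
  polynomial and deg Q > 0, this constant term would be 0.\<close>

lemma invert_X_polynomial:
  assumes "invert_X p = to_fract c"
  shows "p \<in> polys_in (- {1})"
proof -
  have U: "insert 1 (- {1}) = (UNIV :: nat set)" by auto
  have ex: "\<exists>Q\<in>polys_over (polys_in (- {1})). p = poly Q (Var 1)" for p :: "'k mpoly"
    using polys_in_insert[of 1 "- {1}", where 'k='k] unfolding U by (auto simp: poly_values_def)
  obtain Q where Q: "Q \<in> polys_over (polys_in (- {1}))" "p = poly Q (Var 1)"
    using ex by blast
  obtain C where C: "C \<in> polys_over (polys_in (- {1}))" "c = poly C (Var 1)"
    using ex by blast
  have "map_poly invert_X Q = map_poly to_fract Q"
    using Q(1) by (intro poly_eqI) (auto simp: coeff_map_poly polys_over_def invert_X_id)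
  then have p: "invert_X p = poly (map_poly to_fract Q) (inverse X)"
    by (simp add: Q(2) invert_X.poly invert_X_Var divide_inverse del: One_nat_def)
  have deg: "degree (map_poly to_fract Q) = degree Q"
    by (rule degree_map_poly) simp
  have "reflect_poly (map_poly to_fract Q) = map_poly to_fract (reflect_poly Q)"
    by (rule poly_eqI) (simp add: coeff_reflect_poly coeff_map_poly deg)
  then have "to_fract (poly (reflect_poly Q) (Var 1)) = X ^ degree Q * invert_X p"
    using poly_reflect_poly_nz[of X "map_poly to_fract Q"] by (simp add: p to_fract.poly deg del: One_nat_def)
  also have "\<dots> = to_fract (poly (monom 1 (degree Q) * C) (Var 1))"
    by (simp add: assms C(2) poly_monom del: One_nat_def)
  finally have "poly (reflect_poly Q) (Var 1) = poly (monom 1 (degree Q) * C) (Var 1)"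
    by (simp only: to_fract_eq_iff)
  moreover have "reflect_poly Q \<in> polys_over (polys_in (- {1}))" "monom 1 (degree Q) \<in> polys_over (polys_in (- {1}) :: 'k mpoly set)"
    using Q(1) by (auto simp: polys_over_def coeff_reflect_poly)
  ultimately have eq: "reflect_poly Q = monom 1 (degree Q) * C"
    using C(1) by (intro poly_Var_inj[of _ "- {1}" _ 1] subring_mult[OF subring_polys_over] is_subring_polys_in) auto
  have "degree Q = 0"
  proof (rule ccontr)
    assume "degree Q \<noteq> 0"
    then have "coeff (reflect_poly Q) 0 = 0"
      by (simp add: eq coeff_monom_mult)
    then show False using \<open>degree Q \<noteq> 0\<close> by auto
  qed
  then obtain q where "Q = [:q:]"
    by (rule degree_eq_zeroE)
  then show ?thesis
    using Q by (auto simp: polys_over_def dest: spec[of _ 0])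
qed

end

context invariant_field
begin

abbreviation "Rbar \<equiv> epsz ` R"

lemma subring_Rbar: "is_subring Rbar"
  by (intro subring_image epsz.rhom_axioms subring_R)

lemma Const_in_Rbar: "Const c \<in> Rbar"
  using Const_in_R[of c] by (metis epsz_Const image_eqI)

lemma Rbar_subset: "Rbar \<subseteq> polys_in {1}"
proof -
  have "kx \<subseteq> polys_in (- {0})"
    by (rule polys_in_mono) auto
  then show ?thesis
    using R_subset_kx epsz_in_polys_1 by blast
qed

text \<open>\<open>epsz p\<close> is a polynomial in z over \<open>Rbar\<close>. After the shift z
  -> z + h it stays polynomial under x_1 -> 1/x_1, so it is free of x_1 and has coefficients in k;
  now \<open>constant_if_shift_constant\<close> applies.\<close>

lemma epsz_const:
  assumes h: "h \<notin> Rbar" and p: "p \<in> Rz" "tp p = to_fract c"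
  shows "epsz p \<in> range Const"
proof -
  obtain Q where Q: "Q \<in> polys_over R" "p = poly Q (Var 0)"
    using p(1) by (auto simp: Rz_def poly_values_def)
  define Qb where "Qb = map_poly epsz Q"
  have Qb: "Qb \<in> polys_over Rbar"
    using Q(1) by (auto simp: Qb_def polys_over_def coeff_map_poly)
  have e: "epsz p = poly Qb (Var 0)"
    by (simp add: Q(2) epsz.poly Qb_def epsz_Var)
  have "tp (epsz p) = invert_X (poly Qb (Var 0 + h))"
  proof -
    have "map_poly tp Qb = map_poly invert_X Qb"
      using Qb Rbar_subset
      by (intro poly_eqI) (simp add: coeff_map_poly polys_over_def subset_iff tp_eq_invert_X)
    then show ?thesis
      by (simp add: e tp.poly invert_X.poly tp_z invert_X_Var tp_eq_invert_X[OF h_in])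
  qed
  then have in1: "poly Qb (Var 0 + h) \<in> polys_in (- {1})"
    using tp_epsz[OF p(2)] invert_X_polynomial by metis
  \<comment> \<open>The shift is performed on polynomials in z, so that the absence of x_1 can be
    read off from each coefficient.\<close>
  define S where "S = pcompose Qb [:h, 1:]"
  have S: "poly Qb (Var 0 + h) = poly S (Var 0)"
    by (simp add: S_def poly_pcompose add.commute)
  have "Qb \<in> polys_over (polys_in {1})"
    using Qb polys_over_mono[OF Rbar_subset] by auto
  have S_over: "S \<in> polys_over (polys_in {1})"
  proof -
    have hh: "[:h, 1:] \<in> polys_over (polys_in {1})"
      using h_in by (auto simp: polys_over_def coeff_pCons split: nat.split)
    have "pcompose Q' [:h, 1:] \<in> polys_over (polys_in {1})" if "Q' \<in> polys_over (polys_in {1})" for Q'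
      using that
    proof (induction Q')
      case 0
      then show ?case by simp
    next
      case (pCons a q)
      have "a \<in> polys_in {1}" "q \<in> polys_over (polys_in {1})"
        using pCons.prems unfolding polys_over_def by (auto dest: spec[of _ 0] spec[of _ "Suc _"])
      then show ?case
        unfolding pcompose_pCons
        by (intro subring_add subring_mult subring_polys_over is_subring_polys_in const_polys_over pCons.IH hh)
    qed
    from this[OF \<open>Qb \<in> polys_over (polys_in {1})\<close>] show ?thesis
      unfolding S_def .
  qed
  have "coeff S k \<in> polys_in {}" for k
    unfolding polys_in_iff
  proof
    fix m assume m: "m \<in> Poly_Mapping.keys (coeff S k)"
    then have m1: "Poly_Mapping.keys m \<subseteq> {1}"
      using S_over by (auto simp: polys_over_def polys_in_iff)
    then have "Poly_Mapping.lookup m 0 = 0"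
      by (auto simp: in_keys_iff)
    then have "Poly_Mapping.lookup (poly S (Var 0)) (m + Poly_Mapping.single 0 k) = Poly_Mapping.lookup (coeff S k) m"
      by (intro lookup_poly_Var[OF S_over]) auto
    then have "m + Poly_Mapping.single 0 k \<in> Poly_Mapping.keys (poly S (Var 0))"
      using m by (simp add: in_keys_iff)
    then have "Poly_Mapping.lookup (m + Poly_Mapping.single 0 k) 1 = 0"
      using in1 polys_in_lookup unfolding S by blast
    then have "1 \<notin> Poly_Mapping.keys m"
      by (simp add: lookup_add in_keys_iff lookup_single)
    then show "Poly_Mapping.keys m \<subseteq> {}"
      using m1 by blast
  qed
  then have "S \<in> polys_over (range Const)"
    by (auto simp: polys_over_def polys_in_empty)
  then obtain d where "Qb = [:Const d:]"
    using constant_if_shift_constant[OF subring_Rbar _ h Qb] Const_in_Rbar unfolding S_def by blast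
  then show ?thesis
    by (simp add: e)
qed

section \<open>Degree in z against degree in the variables of index at least 2\<close>

definition weight :: "(nat \<Rightarrow>\<^sub>0 nat) \<Rightarrow> nat" where
  "weight m = (\<Sum>i\<in>Poly_Mapping.keys m - {0, 1}. Poly_Mapping.lookup m i)"

lemma weight_superset: "finite S \<Longrightarrow> Poly_Mapping.keys m \<subseteq> S \<Longrightarrow> weight m = (\<Sum>i\<in>S - {0, 1}. Poly_Mapping.lookup m i)"
  unfolding weight_def by (rule sum.mono_neutral_left) (auto simp: in_keys_iff)

lemma weight_add: "weight (m + m') = weight m + weight m'"
proof -
  let ?S = "Poly_Mapping.keys m \<union> Poly_Mapping.keys m'"
  have "finite ?S" "Poly_Mapping.keys m \<subseteq> ?S" "Poly_Mapping.keys m' \<subseteq> ?S" "Poly_Mapping.keys (m + m') \<subseteq> ?S"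
    using keys_add[of m m'] by auto
  then show ?thesis
    by (simp add: weight_superset[of ?S] lookup_add sum.distrib)
qed

lemma weight_eq_0: "weight m = 0 \<Longrightarrow> Poly_Mapping.keys m \<subseteq> {0, 1}"
  by (auto simp: weight_def in_keys_iff)

text \<open>The bound is linear without a constant term and therefore stable under products, which a
  fixed bound on the degree in z would not be.\<close>

definition slope_bounded :: "nat \<Rightarrow> 'k mpoly set" where
  "slope_bounded d = {p. \<forall>m\<in>Poly_Mapping.keys p. Poly_Mapping.lookup m 0 \<le> d * weight m}"

lemma subring_slope_bounded: "is_subring (slope_bounded d)"
  unfolding is_subring_def slope_bounded_def
proof (intro conjI ballI)
  fix a b :: "'k mpoly"
  assume a: "a \<in> {p. \<forall>m\<in>Poly_Mapping.keys p. Poly_Mapping.lookup m 0 \<le> d * weight m}"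
    and b: "b \<in> {p. \<forall>m\<in>Poly_Mapping.keys p. Poly_Mapping.lookup m 0 \<le> d * weight m}"
  have "Poly_Mapping.keys (a - b) \<subseteq> Poly_Mapping.keys a \<union> Poly_Mapping.keys b"
    by (auto simp: in_keys_iff lookup_minus)
  then show "a - b \<in> {p. \<forall>m\<in>Poly_Mapping.keys p. Poly_Mapping.lookup m 0 \<le> d * weight m}"
    using a b by blast
  have "Poly_Mapping.lookup m 0 \<le> d * weight m" if m: "m \<in> Poly_Mapping.keys (a * b)" for m
  proof -
    obtain k l where "m = k + l" "k \<in> Poly_Mapping.keys a" "l \<in> Poly_Mapping.keys b"
      using m keys_mult[of a b] by auto
    then show ?thesis
      using a b by (auto simp: lookup_add weight_add distrib_left intro!: add_mono)
  qed
  then show "a * b \<in> {p. \<forall>m\<in>Poly_Mapping.keys p. Poly_Mapping.lookup m 0 \<le> d * weight m}"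
    by blast
qed simp

lemma Const_slope_bounded: "Const c \<in> slope_bounded d"
  by (auto simp: slope_bounded_def Const_def)

text \<open>A monomial of weight 0 survives in the constant \<open>epsz p\<close>, so it is trivial.
  Any other monomial has weight at least 1, and then \<open>d\<close> alone is within the
  bound.\<close>

lemma A_slope_bounded:
  assumes h: "h \<notin> Rbar" and a: "tp p \<in> A" and d: "\<And>m. m \<in> Poly_Mapping.keys p \<Longrightarrow> Poly_Mapping.lookup m 0 \<le> d"
  shows "p \<in> slope_bounded d"
  unfolding slope_bounded_def
proof (intro CollectI ballI)
  fix m assume m: "m \<in> Poly_Mapping.keys p"
  obtain p' where "p' \<in> Rz" "tp p = tp p'"
    using A_memberE[OF a] by blast
  then have "p = p'" by (simp add: tp_eq_iff)
  obtain c where "tp p = to_fract c"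
    using a by (auto simp: A_def)
  then obtain u where u: "epsz p = Const u"
    using epsz_const[OF h] \<open>p' \<in> Rz\<close> \<open>p = p'\<close> by blast
  show "Poly_Mapping.lookup m 0 \<le> d * weight m"
  proof (cases "weight m = 0")
    case True
    then have "Poly_Mapping.lookup (Const u) m = Poly_Mapping.lookup p m"
      using lookup_epsz[OF weight_eq_0] u by metis
    then have "m = 0"
      using m by (auto simp: Const_def lookup_single when_def in_keys_iff split: if_splits)
    then show ?thesis by simp
  next
    case False
    then show ?thesis
      using d[OF m] by (metis le_trans mult.right_neutral mult_le_mono2 not_less_eq_eq le_zero_eq One_nat_def)
  qed
qed

text \<open>One slope serves for finitely many generators and hence for all of A, whereas the
  monomials m z^N have fixed weight and unbounded degree in z.\<close>

lemma not_finitely_generated: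
  assumes h: "h \<notin> Rbar"
    and q: "\<And>N. tp (q N) \<in> A" "\<And>N. m + Poly_Mapping.single 0 N \<in> Poly_Mapping.keys (q N)"
  shows "\<not> finitely_generated_algebra constants A"
proof
  assume "finitely_generated_algebra constants A"
  then obtain S where S: "finite S" "S \<subseteq> A" "A = ring_adjoin constants S"
    unfolding finitely_generated_algebra_def by blast
  have "\<forall>s\<in>S. \<exists>p. s = tp p"
    using S(2) A_memberE by blast
  then obtain g where g: "\<And>s. s \<in> S \<Longrightarrow> s = tp (g s)"
    by metis
  \<comment> \<open>The inserted 0 keeps the maximum meaningful when there are no monomials.\<close>
  define d where "d = Max (insert 0 ((\<lambda>m. Poly_Mapping.lookup m 0) ` (\<Union>s\<in>S. Poly_Mapping.keys (g s))))"
  have "Poly_Mapping.lookup k 0 \<le> d" if "s \<in> S" "k \<in> Poly_Mapping.keys (g s)" for s k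
    unfolding d_def using S(1) that by (intro Max_ge) auto
  then have "g s \<in> slope_bounded d" if "s \<in> S" for s
    using that S(2) g by (intro A_slope_bounded[OF h]) (metis subsetD, metis)
  then have "S \<subseteq> tp ` slope_bounded d"
    using g by blast
  moreover have "constants \<subseteq> tp ` slope_bounded d"
    using Const_slope_bounded tp_Const unfolding constants_def by (metis image_eqI image_subsetI)
  ultimately have "A \<subseteq> tp ` slope_bounded d"
    unfolding S(3) ring_adjoin_def
    by (intro hull_minimal subring_image theta_poly_rhom subring_slope_bounded) auto
  then have "tp (q N) \<in> tp ` slope_bounded d" for N
    using q(1)[of N] by blast
  then have "q N \<in> slope_bounded d" for N
    by (auto simp: tp_eq_iff image_iff)
  then have "N \<le> d * weight (m + Poly_Mapping.single 0 N)" for N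
    using q(2)[of N] by (fastforce simp: slope_bounded_def lookup_add)
  moreover have "weight (Poly_Mapping.single 0 N) = 0" for N
    by (simp add: weight_def)
  ultimately have "N \<le> d * weight m" for N
    by (simp add: weight_add)
  from this[of "Suc (d * weight m)"] show False by simp
qed

end

section \<open>Regular elements of arbitrarily large degree in z\<close>

text \<open>The Taylor expansion of an Appell polynomial: the coefficient of v^j is binom(N, j)
  times the (N - j)-th member of the sequence at u. It follows by exchanging sums and binom(N, k)
  binom(k, j) = binom(N, j) binom(N - j, k - j).\<close>

lemma appell_shift:
  fixes a :: "nat \<Rightarrow> 'a::comm_ring_1"
  shows "(\<Sum>i\<le>N. of_nat (N choose i) * a (N - i) * (u + v) ^ i) =
    (\<Sum>j\<le>N. of_nat (N choose j) * (\<Sum>i\<le>N - j. of_nat (N - j choose i) * a (N - j - i) * u ^ i) * v ^ j)"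
proof -
  define G where "G j i = of_nat ((N choose (j + i)) * (j + i choose j)) * a (N - j - i) * u ^ i * v ^ j" for j i
  have "(\<Sum>i\<le>N. of_nat (N choose i) * a (N - i) * (u + v) ^ i) = (\<Sum>k\<le>N. \<Sum>j\<le>k. G j (k - j))"
  proof (rule sum.cong[OF refl])
    fix k
    have "of_nat (N choose k) * a (N - k) * (u + v) ^ k = 
        of_nat (N choose k) * a (N - k) * (\<Sum>j\<le>k. of_nat (k choose j) * v ^ j * u ^ (k - j))"
      by (simp add: binomial_ring[of v u k] add.commute[of u v])
    also have "\<dots> = (\<Sum>j\<le>k. G j (k - j))"
      unfolding sum_distrib_left by (rule sum.cong) (auto simp: G_def mult_ac)
    finally show "of_nat (N choose k) * a (N - k) * (u + v) ^ k = (\<Sum>j\<le>k. G j (k - j))" .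
  qed
  also have "\<dots> = (\<Sum>(j, i)\<in>{(j, i). j + i \<le> N}. G j i)"
    by (rule sum.triangle_reindex_eq[symmetric])
  also have "{(j, i). j + i \<le> N} = Sigma {..N} (\<lambda>j. {..N - j})"
    by auto
  also have "(\<Sum>(j, i)\<in>Sigma {..N} (\<lambda>j. {..N - j}). G j i) = (\<Sum>j\<le>N. \<Sum>i\<le>N - j. G j i)"
    by (rule sum.Sigma[symmetric]) auto
  also have "\<dots> = (\<Sum>j\<le>N. of_nat (N choose j) * (\<Sum>i\<le>N - j. of_nat (N - j choose i) * a (N - j - i) * u ^ i) * v ^ j)"
  proof (rule sum.cong[OF refl])
    fix j assume "j \<in> {..N}"
    then have "G j i = of_nat (N choose j) * (of_nat (N - j choose i) * a (N - j - i) * u ^ i) * v ^ j" if "i \<le> N - j" for i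
    proof -
      have "(N choose (j + i)) * (j + i choose j) = (N choose j) * (N - j choose i)"
        using that \<open>j \<in> {..N}\<close> choose_mult[of j "j + i" N] by simp
      then show ?thesis
        unfolding G_def by (simp add: mult_ac)
    qed
    then show "(\<Sum>i\<le>N - j. G j i) = of_nat (N choose j) * (\<Sum>i\<le>N - j. of_nat (N - j choose i) * a (N - j - i) * u ^ i) * v ^ j"
      by (simp add: sum_distrib_left sum_distrib_right)
  qed
  finally show ?thesis .
qed

lemma polys_over_pConsD:
  assumes "pCons a q \<in> polys_over B"
  shows "a \<in> B" "q \<in> polys_over B"
proof -
  have "coeff (pCons a q) i \<in> B" for i
    using assms by (simp add: polys_over_def)
  from this[of 0] this[of "Suc _"] show "a \<in> B" "q \<in> polys_over B"
    by (simp_all add: polys_over_def)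
qed

section \<open>Poles along x_1 = 0\<close>

definition at_zero :: "nat \<Rightarrow> 'k::field mpoly \<Rightarrow> 'k mpoly" where
  "at_zero j = peval Const (\<lambda>i. if i = j then 0 else Var i)"

interpretation at_zero: rhom "at_zero j :: 'k::field mpoly \<Rightarrow> _"
  unfolding at_zero_def by (rule rhom_peval[OF rhom_Const])

lemma at_zero_Const [simp]: "at_zero j (Const c) = Const c"
  by (simp add: at_zero_def peval_Const rhom_Const)

lemma at_zero_Var: "at_zero j (Var i) = (if i = j then 0 else Var i)"
  by (simp add: at_zero_def peval_Var rhom_Const)

lemma Var_dvd_diff_at_zero: "Var j dvd p - at_zero j p"
proof -
  have "p \<in> polys_in UNIV" by simp
  then show ?thesis
  proof (induction rule: mpoly_induct)
    case (add p q)
    then show ?case using dvd_add[OF add] by (simp add: algebra_simps)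
  next
    case (mult p q)
    have "p * q - at_zero j (p * q) = p * (q - at_zero j q) + at_zero j q * (p - at_zero j p)"
      by (simp add: algebra_simps)
    then show ?case using mult by (metis dvd_add dvd_mult)
  qed (auto simp: at_zero_Var)
qed

text \<open>So \<open>Var j\<close> generates the kernel of a homomorphism into an integral domain.
  Primality of x_1 is used below in this form.\<close>

lemma at_zero_eq_0_iff: "at_zero j p = 0 \<longleftrightarrow> Var j dvd p"
proof
  assume "at_zero j p = 0"
  then show "Var j dvd p" using Var_dvd_diff_at_zero[of j p] by simp
qed (auto simp: at_zero_Var)

lemma polys_in_Int: "p \<in> polys_in V \<Longrightarrow> p \<in> polys_in W \<Longrightarrow> p \<in> polys_in (V \<inter> W)"
  by (auto simp: polys_in_def)

lemma Var_mult_in_polysD: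
  assumes "Var i * p \<in> polys_in V"
  shows "(p :: 'k::field mpoly) \<in> polys_in V"
  unfolding polys_in_iff
proof
  fix m assume "m \<in> Poly_Mapping.keys p"
  then have "m + Poly_Mapping.single i 1 \<in> Poly_Mapping.keys (Var i * p)"
    using lookup_mult_Var_power[of p i 1 m] by (simp add: in_keys_iff mult.commute)
  then have "Poly_Mapping.keys (m + Poly_Mapping.single i 1) \<subseteq> V"
    using assms by (auto simp: polys_in_iff)
  then show "Poly_Mapping.keys m \<subseteq> V"
    by (auto simp: in_keys_iff lookup_add)
qed

context theta_subst
begin

text \<open>The local ring of the polynomial ring at the prime x_1, that is, the fractions of
  nonnegative order along x_1 = 0.\<close>

definition regular :: "'k mpoly fract set" where
  "regular = {to_fract a / to_fract b | a b. \<not> Var 1 dvd b}"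

lemma subring_regular: "is_subring regular"
  unfolding is_subring_def
proof (intro conjI ballI)
  have "\<not> Var 1 dvd (1 :: 'k mpoly)"
    unfolding at_zero_eq_0_iff[symmetric] by simp
  then show "1 \<in> regular"
    unfolding regular_def by (intro CollectI exI[of _ 1]) simp
  fix x y assume "x \<in> regular" "y \<in> regular"
  then obtain a b c d where *: "x = to_fract a / to_fract b" "y = to_fract c / to_fract d" "\<not> Var 1 dvd b" "\<not> Var 1 dvd d"
    unfolding regular_def by blast
  have bd: "\<not> Var 1 dvd (b * d)"
    using *(3,4) unfolding at_zero_eq_0_iff[symmetric] by simp
  have "b \<noteq> 0" "d \<noteq> 0" using *(3,4) by auto
  then have "x - y = to_fract (a * d - c * b) / to_fract (b * d)" "x * y = to_fract (a * c) / to_fract (b * d)"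
    by (simp_all add: * diff_frac_eq)
  then show "x - y \<in> regular" "x * y \<in> regular"
    unfolding regular_def using bd by blast+
qed

lemma to_fract_regular: "to_fract p \<in> regular"
proof -
  have "\<not> Var 1 dvd (1 :: 'k mpoly)"
    unfolding at_zero_eq_0_iff[symmetric] by simp
  then show ?thesis
    unfolding regular_def by (intro CollectI exI[of _ p] exI[of _ 1]) simp
qed

text \<open>If y = a/b and x_1^(K+1) y = p, then x_1 divides p b but not b, so it divides p, and one
  factor x_1 can be cancelled without leaving k[V].\<close>

lemma regular_inter_loc:
  assumes "y \<in> regular" "y \<in> loc V"
  shows "y \<in> to_fract ` polys_in V"
proof -
  obtain a b where ab: "y = to_fract a / to_fract b" "\<not> Var 1 dvd b"
    using assms(1) unfolding regular_def by blast
  then have "b \<noteq> 0" by auto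
  have "y \<in> to_fract ` polys_in V" if "p \<in> polys_in V" "X ^ K * y = to_fract p" for K p
    using that
  proof (induction K arbitrary: p)
    case (Suc K)
    have "to_fract (p * b) = X * X ^ K * (y * to_fract b)"
      using Suc.prems(2) by (simp add: mult_ac)
    also have "\<dots> = to_fract (Var 1 * (Var 1 ^ K * a))"
      using ab(1) \<open>b \<noteq> 0\<close> by simp
    finally have "p * b = Var 1 * (Var 1 ^ K * a)"
      by (simp only: to_fract_eq_iff)
    then have "at_zero 1 p * at_zero 1 b = 0"
      by (metis at_zero.mult at_zero_eq_0_iff dvd_triv_left)
    then have "Var 1 dvd p"
      using ab(2) unfolding at_zero_eq_0_iff[symmetric] by simp
    then obtain p' where p': "p = Var 1 * p'" by (elim dvdE)
    then have "X * (X ^ K * y) = X * to_fract p'"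
      using Suc.prems(2) by (simp add: mult.assoc)
    then have "X ^ K * y = to_fract p'" by simp
    then show ?case
      using Suc.IH Var_mult_in_polysD Suc.prems(1) p' by blast
  qed auto
  then show ?thesis
    using assms(2) unfolding loc_def by blast
qed

text \<open>The hypotheses say that y has order at most 0. Cancelling x_1 in
  \<open>X ^ K * y = to_fract p\<close> ends with a numerator not divisible by x_1, which becomes
  the denominator of 1/y.\<close>

lemma inverse_regular:
  assumes "y \<in> loc UNIV" "y \<noteq> 0" "\<And>p. y \<noteq> to_fract (Var 1 * p)"
  shows "1 / y \<in> regular"
proof -
  have "1 / y \<in> regular" if "X ^ K * y = to_fract p" for K p
    using that
  proof (induction K arbitrary: p)
    case 0
    then have y: "y = to_fract p" by simp
    then have "\<not> Var 1 dvd p"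
      using assms(3) by (metis dvdE)
    then show ?case
      unfolding regular_def y by (intro CollectI exI[of _ 1] exI[of _ p]) simp
  next
    case (Suc K)
    show ?case
    proof (cases "Var 1 dvd p")
      case True
      then obtain p' where p': "p = Var 1 * p'" by (elim dvdE)
      then have "X * (X ^ K * y) = X * to_fract p'"
        using Suc.prems by (simp add: mult.assoc)
      then have "X ^ K * y = to_fract p'" by simp
      then show ?thesis by (rule Suc.IH)
    next
      case False
      have "1 / y = to_fract (Var 1 ^ Suc K) / to_fract p"
        using Suc.prems assms(2) by (simp flip: Suc.prems del: power_Suc)
      then show ?thesis
        unfolding regular_def using False by blast
    qed
  qed
  then show ?thesis
    using assms(1) unfolding loc_def by blast
qed

text \<open>If x_1 divided \<theta>(p), it would also divide \<theta>(epsz p) by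
  \<open>tp_epsz\<close>. But \<open>epsz p\<close> lies in k[x_1] and would be constant, since its
  image under x_1 -> 1/x_1 is a polynomial; a constant divisible by x_1 is 0.\<close>

lemma inverse_tp_regular:
  assumes "p \<in> polys_in (- {0})" "epsz p \<noteq> 0"
  shows "1 / tp p \<in> regular"
proof (rule inverse_regular)
  show "tp p \<in> loc UNIV" by (rule tp_in_loc) auto
  show "tp p \<noteq> 0" using assms(2) by auto
  fix q
  show "tp p \<noteq> to_fract (Var 1 * q)"
  proof
    assume "tp p = to_fract (Var 1 * q)"
    then have e: "tp (epsz p) = to_fract (Var 1 * epsz q)"
      using tp_epsz[of p "Var 1 * q"] by (simp add: epsz_Var)
    have e1: "epsz p \<in> polys_in {1}"
      using assms(1) by (rule epsz_in_polys_1)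
    then have "epsz p \<in> polys_in (- {1})"
      using e invert_X_polynomial tp_eq_invert_X by metis
    then have "epsz p \<in> polys_in {}"
      using e1 polys_in_Int[of "epsz p" "- {1}" "{1}"] by simp
    then obtain c where c: "epsz p = Const c"
      by (auto simp: polys_in_empty)
    then have "Const c = Var 1 * epsz q"
      using e by (simp only: tp_Const to_fract_eq_iff)
    then have "at_zero 1 (Const c) = 0"
      unfolding at_zero_eq_0_iff by simp
    then show False
      using assms(2) c by simp
  qed
qed

end

lemma subring_poly_values_Const: "is_subring (poly_values (range (Const :: 'k::comm_ring_1 \<Rightarrow> _)) y)"
  by (intro subring_poly_values subring_range_Const)

section \<open>The ring k[f,g] and the poles of the images of its fractions\<close>

locale double_dagger = invariant_field n t h M for n t and h :: "'k::field_char_0 mpoly" and M +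
  fixes f g :: "'k mpoly" and P :: "'k mpoly poly"
  assumes f: "f \<in> R" and g: "g \<in> R" "epsz g \<noteq> 0"
    and P: "lead_coeff P = 1" "P \<in> polys_over (poly_values (range Const) g)"
    and epsz_P: "epsz (poly P f) = 0"
    and tp_w: "tp (f - g * h) \<in> to_fract ` kx"
    and tp_P: "tp (poly P f) \<in> (\<lambda>p. to_fract (Var 1 * p)) ` kx"
begin

abbreviation "kg \<equiv> poly_values (range Const) g"

text \<open>This is k[f,g], built as k[g][f] to fit the division by \<open>P\<close>, which is monic
  over k[g].\<close>

definition D :: "'k mpoly set" where
  "D = poly_values kg f"

abbreviation pi :: "'k mpoly" where "pi \<equiv> poly P f"

lemma subring_kg: "is_subring kg"
  by (rule subring_poly_values_Const)

lemma subring_D: "is_subring D"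
  unfolding D_def by (intro subring_poly_values subring_kg)

lemma kg_subset_D: "kg \<subseteq> D" and f_in_D: "f \<in> D"
  unfolding D_def using subset_poly_values[OF subring_kg] self_in_poly_values[OF subring_kg] by auto

lemma g_in_kg: "g \<in> kg"
  by (rule self_in_poly_values[OF subring_range_Const])

lemma Const_in_kg: "Const c \<in> kg"
  using subset_poly_values[OF subring_range_Const] by blast

lemma D_subset_R: "D \<subseteq> R"
  unfolding D_def using Const_in_R f g by (intro poly_values_subset subring_R) auto

lemma pi_in_D: "pi \<in> D"
  unfolding D_def poly_values_def[of kg] using P(2) by (rule imageI)

lemma degree_P: "degree P > 0"
proof (rule ccontr)
  assume "\<not> degree P > 0"
  then have "P = [:1:]"
    using P(1) by (auto elim: degree_eq_zeroE)
  then show False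
    using epsz_P by simp
qed

lemma kx_pos: "kx \<subseteq> polys_in (- {0})"
  by (rule polys_in_mono) auto

lemma tp_g_neq_0: "tp g \<noteq> 0"
  using g(2) by auto

lemma inverse_tp_g: "1 / tp g \<in> regular"
  using g R_subset_kx kx_pos by (intro inverse_tp_regular) auto

text \<open>\<open>tp pi\<close> is x_1 times a polynomial, so each factor cancels one x_1 in the
  denominator. The additional exponent \<open>j\<close> allows several such bounds to be raised to a
  common one.\<close>

lemma pi_power_clears:
  assumes "1 \<in> V" "{1..n} \<subseteq> V" "y \<in> loc V"
  shows "\<exists>K. \<forall>j. tp pi ^ (K + j) * y \<in> to_fract ` polys_in V"
proof -
  obtain K p where p: "p \<in> polys_in V" "X ^ K * y = to_fract p"
    using assms(3) unfolding loc_def by blast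
  obtain c where c: "c \<in> kx" "tp pi = to_fract (Var 1 * c)"
    using tp_P by blast
  have "c \<in> polys_in V"
    using c(1) polys_in_mono[OF assms(2)] by blast
  have "tp pi ^ (K + j) * y = to_fract ((Var 1 * c) ^ j * (c ^ K * p))" for j
    by (simp add: c(2) p(2)[symmetric] power_add power_mult_distrib mult_ac)
  moreover have "(Var 1 * c) ^ j * (c ^ K * p) \<in> polys_in V" for j
    using \<open>c \<in> polys_in V\<close> p(1) assms(1)
    by (intro subring_mult subring_power is_subring_polys_in Var_in_polys)
  ultimately show ?thesis by blast
qed

lemma tp_pi_regular: "tp pi \<in> regular"
  using tp_P to_fract_regular by (metis imageE)

text \<open>Such an \<open>l\<close> does not depend on N: the factor \<open>pi ^ l\<close> absorbs
  the poles of all powers of f that remain after reduction by \<open>P\<close>.\<close>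

definition good_exponent :: "nat \<Rightarrow> bool" where
  "good_exponent l \<longleftrightarrow> (\<forall>j<degree P. tp pi ^ l * tp f ^ j \<in> regular)"

lemma good_exponent_ex: "\<exists>l. good_exponent l"
proof -
  obtain K where K: "\<And>j. tp pi ^ (K + j) * tp f \<in> to_fract ` (polys_in UNIV :: 'k mpoly set)"
    using pi_power_clears[of UNIV "tp f"] tp_in_loc[of UNIV f] by auto
  have 1: "tp pi ^ K * tp f \<in> regular"
    using K[of 0] to_fract_regular by auto
  \<comment> \<open>This exponent provides K factors \<open>tp pi\<close> for each of the fewer than
    \<open>degree P\<close> factors \<open>tp f\<close>.\<close>
  have "tp pi ^ (K * degree P) * tp f ^ j \<in> regular" if "j < degree P" for j
  proof -
    have "tp pi ^ (K * degree P) * tp f ^ j = (tp pi ^ K * tp f) ^ j * tp pi ^ (K * (degree P - j))"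
    proof -
      have "K * degree P = K * j + K * (degree P - j)"
        using that by (simp flip: distrib_left)
      then show ?thesis
        by (simp add: power_add power_mult power_mult_distrib mult_ac)
    qed
    then show ?thesis
      using 1 tp_pi_regular by (simp add: subring_mult subring_power subring_regular)
  qed
  then show ?thesis unfolding good_exponent_def by blast
qed

lemma kg_split:
  assumes "c \<in> kg"
  obtains k c' where "c' \<in> kg" "c = Const k + g * c'"
proof -
  obtain Q where Q: "Q \<in> polys_over (range Const)" "c = poly Q g"
    using assms unfolding poly_values_def by blast
  obtain q Q' where Q': "Q = pCons q Q'" by (cases Q)
  have "q \<in> range Const" "Q' \<in> polys_over (range Const)"
    using Q(1) polys_over_pConsD unfolding Q' by blast+
  then show thesis
    using Q(2) Q' that unfolding poly_values_def by auto
qed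

text \<open>Expand c/g^s in powers of g. The terms with nonnegative exponent form \<open>c'\<close>;
  those with negative exponent have no pole, since 1/\<theta>(g) has none.\<close>

lemma kg_divide_power:
  assumes "c \<in> kg"
  shows "\<exists>c'\<in>kg. tp c / tp g ^ s - tp c' \<in> regular"
  using assms
proof (induction s arbitrary: c)
  case 0
  then show ?case by (auto intro!: bexI[of _ c] subring_zero subring_regular)
next
  case (Suc s)
  obtain k c1 where c1: "c1 \<in> kg" "c = Const k + g * c1"
    using kg_split[OF Suc.prems] .
  obtain c' where c': "c' \<in> kg" "tp c1 / tp g ^ s - tp c' \<in> regular"
    using Suc.IH[OF c1(1)] by blast
  have "tp c / tp g ^ Suc s - tp c' = to_fract (Const k) * (1 / tp g) ^ Suc s + (tp c1 / tp g ^ s - tp c')"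
    using tp_g_neq_0 by (simp add: c1(2) add_divide_distrib power_divide)
  moreover have "to_fract (Const k) * (1 / tp g) ^ Suc s \<in> regular"
    by (intro subring_mult subring_power subring_regular to_fract_regular inverse_tp_g)
  ultimately have "tp c / tp g ^ Suc s - tp c' \<in> regular"
    using c'(2) subring_add[OF subring_regular] by metis
  then show ?case using c'(1) by blast
qed

text \<open>The elements whose pole can be removed by subtracting the image of an admissible Appell
  coefficient.\<close>

definition approximable :: "nat \<Rightarrow> 'k mpoly fract set" where
  "approximable l = {u. \<exists>d\<in>D. u - tp (pi ^ l * d) \<in> regular}"

lemma approximable_add:
  assumes "u \<in> approximable l" "v \<in> approximable l"
  shows "u + v \<in> approximable l"
proof -
  obtain d e where "d \<in> D" "e \<in> D" "u - tp (pi ^ l * d) \<in> regular" "v - tp (pi ^ l * e) \<in> regular"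
    using assms unfolding approximable_def by blast
  moreover have "u + v - tp (pi ^ l * (d + e)) = (u - tp (pi ^ l * d)) + (v - tp (pi ^ l * e))"
    by (simp add: distrib_left)
  ultimately show ?thesis
    unfolding approximable_def using subring_add[OF subring_regular] subring_add[OF subring_D] by (metis (mono_tags, lifting) mem_Collect_eq)
qed

lemma approximable_uminus:
  assumes "u \<in> approximable l"
  shows "- u \<in> approximable l"
proof -
  obtain d where "d \<in> D" "u - tp (pi ^ l * d) \<in> regular"
    using assms unfolding approximable_def by blast
  moreover have "- u - tp (pi ^ l * (- d)) = - (u - tp (pi ^ l * d))"
    by simp
  ultimately show ?thesis
    unfolding approximable_def using subring_uminus[OF subring_regular] subring_uminus[OF subring_D] by (metis (mono_tags, lifting) mem_Collect_eq)
qed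

lemma approximable_0: "0 \<in> approximable l"
  unfolding approximable_def using subring_zero[OF subring_D] subring_zero[OF subring_regular] by force

lemma approximable_sum: "(\<And>x. x \<in> S \<Longrightarrow> u x \<in> approximable l) \<Longrightarrow> sum u S \<in> approximable l"
  by (induction S rule: infinite_finite_induct) (auto intro: approximable_0 approximable_add)

text \<open>From \<open>degree P\<close> on, powers of f are rewritten by means of \<open>P\<close>,
  which lowers the exponent of f and at most raises that of \<open>pi\<close>. Below
  \<open>degree P\<close>, the polynomial part of c/g^s gives an element of \<open>D\<close>; the
  rest is regular, and \<open>pi ^ l\<close> absorbs the pole of f^i.\<close>

lemma approximable_monomial:
  assumes l: "good_exponent l" and c: "c \<in> kg"
  shows "tp pi ^ (l + a) * tp f ^ i * tp c / tp g ^ s \<in> approximable l"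
  using c
proof (induction i arbitrary: a c rule: less_induct)
  case (less i)
  show ?case
  proof (cases "i < degree P")
    case True
    obtain c' where c': "c' \<in> kg" "tp c / tp g ^ s - tp c' \<in> regular"
      using kg_divide_power[OF less.prems] by blast
    have "tp pi ^ (l + a) * tp f ^ i * tp c / tp g ^ s - tp (pi ^ l * (pi ^ a * f ^ i * c')) =
        tp pi ^ a * (tp pi ^ l * tp f ^ i) * (tp c / tp g ^ s - tp c')"
      by (simp add: power_add algebra_simps)
    moreover have "tp pi ^ a * (tp pi ^ l * tp f ^ i) * (tp c / tp g ^ s - tp c') \<in> regular"
    proof -
      have "tp pi ^ l * tp f ^ i \<in> regular"
        using l True by (simp add: good_exponent_def)
      from subring_mult[OF subring_regular this c'(2)]
        subring_power[OF subring_regular tp_pi_regular, of a] show ?thesis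
        by (simp add: mult.assoc subring_mult[OF subring_regular])
    qed
    moreover have "pi ^ a * f ^ i * c' \<in> D"
      using c'(1) kg_subset_D by (intro subring_mult subring_power subring_D pi_in_D f_in_D) auto
    ultimately show ?thesis
      unfolding approximable_def by (metis (mono_tags, lifting) mem_Collect_eq)
  next
    case False
    define m where "m = degree P"
    have m: "m > 0" "m \<le> i" using degree_P False by (auto simp: m_def)
    have "pi = (\<Sum>j<m. coeff P j * f ^ j) + f ^ m"
      using P(1) by (simp add: poly_altdef m_def lessThan_Suc_atMost[symmetric] add.commute)
    then have "tp pi = (\<Sum>j<m. tp (coeff P j) * tp f ^ j) + tp f ^ m"
      by simp
    then have fm: "tp f ^ m = tp pi - (\<Sum>j<m. tp (coeff P j) * tp f ^ j)"
      by simp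
    have "tp pi ^ (l + a) * tp f ^ i * tp c / tp g ^ s
        = tp pi ^ (l + a) * tp f ^ (i - m) * tp f ^ m * tp c / tp g ^ s"
      using m(2) by (simp add: mult.assoc flip: power_add)
    also have "\<dots> = tp pi ^ (l + Suc a) * tp f ^ (i - m) * tp c / tp g ^ s
        + - (\<Sum>j<m. tp pi ^ (l + a) * tp f ^ (i - m + j) * tp (coeff P j * c) / tp g ^ s)"
      unfolding fm by (simp add: algebra_simps sum_distrib_left sum_distrib_right diff_divide_distrib sum_divide_distrib power_add)
    also have "\<dots> \<in> approximable l"
    proof (intro approximable_add approximable_uminus approximable_sum less.IH)
      fix j assume "j \<in> {..<m}"
      then show "i - m + j < i" using m by auto
      show "coeff P j * c \<in> kg"
        using P(2) less.prems by (intro subring_mult subring_kg) (auto simp: polys_over_def)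
    qed (use m less.prems in auto)
    finally show ?thesis .
  qed
qed

lemma approximable_D:
  assumes l: "good_exponent l" and d: "d \<in> D"
  shows "tp (pi ^ l * d) * tp f ^ i / tp g ^ s \<in> approximable l"
proof -
  obtain Q where Q: "Q \<in> polys_over kg" "d = poly Q f"
    using d unfolding D_def poly_values_def by blast
  have "tp (pi ^ l * d) * tp f ^ i / tp g ^ s = (\<Sum>j\<le>degree Q. tp pi ^ (l + 0) * tp f ^ (i + j) * tp (coeff Q j) / tp g ^ s)"
    by (simp add: Q(2) poly_altdef sum_distrib_left sum_distrib_right sum_divide_distrib power_add mult_ac)
  also have "\<dots> \<in> approximable l"
    by (intro approximable_sum approximable_monomial l) (use Q(1) in \<open>auto simp: polys_over_def\<close>)
  finally show ?thesis .
qed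

text \<open>The image under \<theta> of q_k(f/g), where q_k is the k-th Appell polynomial with
  coefficients \<open>r\<close>.\<close>

definition appell :: "(nat \<Rightarrow> 'k mpoly) \<Rightarrow> nat \<Rightarrow> 'k mpoly fract" where
  "appell r k = (\<Sum>i\<le>k. of_nat (k choose i) * tp (r (k - i)) * (tp f / tp g) ^ i)"

text \<open>The coefficients are found one after the other. The entry r_(N+1) does not occur in q_k
  for k \<le> N and is the constant term of q_(N+1), so it can be chosen to cancel the pole of all
  other summands of q_(N+1)(f/g).\<close>

lemma appell_sequence:
  assumes l: "good_exponent l"
  shows "\<exists>r. r 0 = pi ^ l \<and> (\<forall>j. \<exists>d\<in>D. r j = pi ^ l * d) \<and> (\<forall>k\<le>N. appell r k \<in> regular)"
proof (induction N)
  case 0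
  \<comment> \<open>With this start the entries not yet chosen are multiples of
    \<open>pi ^ l\<close> as well.\<close>
  have "appell (\<lambda>j. pi ^ l) 0 \<in> regular"
    by (simp add: appell_def subring_power subring_regular tp_pi_regular)
  then show ?case
    using subring_one[OF subring_D] by (intro exI[of _ "\<lambda>j. pi ^ l"]) force
next
  case (Suc N)
  then obtain r where r: "r 0 = pi ^ l" "\<And>j. \<exists>d\<in>D. r j = pi ^ l * d" "\<And>k. k \<le> N \<Longrightarrow> appell r k \<in> regular"
    by blast
  \<comment> \<open>\<open>T\<close> is the image of q_(N+1)(f/g) without its constant term; hence
    the index shift by one.\<close>
  define T where "T = (\<Sum>i\<le>N. of_nat (Suc N choose Suc i) * tp (r (N - i)) * (tp f / tp g) ^ Suc i)"
  have "T \<in> approximable l"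
    unfolding T_def
  proof (rule approximable_sum)
    fix i assume "i \<in> {..N}"
    obtain d where d: "d \<in> D" "r (N - i) = pi ^ l * d"
      using r(2) by blast
    have "of_nat (Suc N choose Suc i) * tp (r (N - i)) * (tp f / tp g) ^ Suc i
       = tp (pi ^ l * (of_nat (Suc N choose Suc i) * d)) * tp f ^ Suc i / tp g ^ Suc i"
      by (simp add: d(2) power_divide mult_ac del: binomial_Suc_Suc power_Suc)
    also have "\<dots> \<in> approximable l"
      by (intro approximable_D l subring_mult subring_of_nat subring_D d)
    finally show "of_nat (Suc N choose Suc i) * tp (r (N - i)) * (tp f / tp g) ^ Suc i \<in> approximable l" .
  qed
  then obtain e where e: "e \<in> D" "T - tp (pi ^ l * e) \<in> regular"
    unfolding approximable_def by blast
  define r' where "r' = r(Suc N := pi ^ l * (- e))"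
  have "appell r' (Suc N) = T - tp (pi ^ l * e)"
    unfolding appell_def by (subst sum.atMost_Suc_shift) (simp add: r'_def T_def del: binomial_Suc_Suc power_Suc, rule sum.cong, auto)
  moreover have "appell r' k = appell r k" if "k \<le> N" for k
    unfolding appell_def r'_def by (rule sum.cong) (use that in auto)
  ultimately have "\<forall>k\<le>Suc N. appell r' k \<in> regular"
    using e(2) r(3) by (auto simp: le_Suc_eq)
  moreover have "\<forall>j. \<exists>d\<in>D. r' j = pi ^ l * d"
    using r(2) subring_uminus[OF subring_D e(1)] by (auto simp: r'_def intro: bexI[of _ "- e"])
  moreover have "r' 0 = pi ^ l"
    by (simp add: r'_def r(1))
  ultimately show ?case by blast
qed

text \<open>Take q = q_N(z). As \<theta>(z) and \<theta>(f/g) differ by a regular element,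
  \<open>appell_shift\<close> reduces regularity of \<theta>(q) to that of the values at f/g. Since
  \<theta>(q) also lies in the localization, it is a polynomial.\<close>

lemma A_element_ex:
  assumes l: "good_exponent l"
  shows "\<exists>q. tp q \<in> A \<and> (\<forall>m\<in>Poly_Mapping.keys (pi ^ l). m + Poly_Mapping.single 0 N \<in> Poly_Mapping.keys q)"
proof -
  obtain r where r: "r 0 = pi ^ l" "\<And>j. \<exists>d\<in>D. r j = pi ^ l * d" "\<And>k. k \<le> N \<Longrightarrow> appell r k \<in> regular"
    using appell_sequence[OF l] by blast
  have rR: "r j \<in> R" for j
    using r(2)[of j] D_subset_R pi_in_D by (auto intro!: subring_mult subring_power subring_R)
  define Q where "Q = (\<Sum>i\<le>N. monom (of_nat (N choose i) * r (N - i)) i)"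
  have cQ: "coeff Q k = (if k \<le> N then of_nat (N choose k) * r (N - k) else 0)" for k
    by (simp add: Q_def coeff_sum)
  have Q: "Q \<in> polys_over R"
    using rR by (auto simp: polys_over_def cQ intro!: subring_intros subring_R)
  define q where "q = poly Q (Var 0)"
  have q: "q \<in> Rz"
    unfolding q_def Rz_def poly_values_def using Q by blast
  \<comment> \<open>This is \<theta>(z) - \<theta>(f/g), rewritten with \<theta>(z) = z +
    \<theta>(h) so that the polynomial \<theta>(f - gh) appears.\<close>
  define y where "y = to_fract (Var 0) - tp (f - g * h) * (1 / tp g)"
  have y: "y \<in> regular"
    unfolding y_def using tp_w
    by (intro subring_diff subring_mult subring_regular inverse_tp_g to_fract_regular) (auto simp: to_fract_regular simp del: tp.diff to_fract.diff)
  have z: "tp (Var 0) = tp f / tp g + y"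
    using tp_g_neq_0 by (simp add: y_def tp_z field_simps)
  have "tp q = (\<Sum>i\<le>N. of_nat (N choose i) * tp (r (N - i)) * (tp f / tp g + y) ^ i)"
    by (simp add: q_def Q_def poly_sum poly_monom flip: z)
  also have "\<dots> = (\<Sum>j\<le>N. of_nat (N choose j) * appell r (N - j) * y ^ j)"
    unfolding appell_def by (rule appell_shift)
  also have "\<dots> \<in> regular"
    using r(3) y by (intro subring_sum subring_mult subring_power subring_of_nat subring_regular) auto
  finally have "tp q \<in> regular" .
  moreover have "tp q \<in> loc {0..n}"
    using q Rz_subset_kxz n by (intro tp_in_loc) auto
  ultimately have "tp q \<in> A"
    using q by (intro A_memberI regular_inter_loc)
  \<comment> \<open>The coefficient of z^N in q is r_0 = pi^l. All coefficients are free of z, so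
    nothing cancels its monomials.\<close>
  moreover have "m + Poly_Mapping.single 0 N \<in> Poly_Mapping.keys q" if m: "m \<in> Poly_Mapping.keys (pi ^ l)" for m
  proof -
    have Q': "Q \<in> polys_over (polys_in {1..n})"
      using Q polys_over_mono[OF R_subset_kx] by blast
    have "pi ^ l \<in> polys_in {1..n}"
      using rR[of 0] r(1) R_subset_kx by auto
    then have "Poly_Mapping.lookup m 0 = 0"
      using polys_in_lookup[OF _ m] by auto
    then have "Poly_Mapping.lookup q (m + Poly_Mapping.single 0 N) = Poly_Mapping.lookup (pi ^ l) m"
      unfolding q_def using lookup_poly_Var[OF Q', of 0 m N] by (simp add: cQ r(1))
    then show ?thesis using m by (simp add: in_keys_iff)
  qed
  ultimately show ?thesis by blast
qed

lemma A_not_fg: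
  assumes "h \<notin> Rbar" "pi \<noteq> 0"
  shows "\<not> finitely_generated_algebra constants A"
proof -
  obtain l where l: "good_exponent l" using good_exponent_ex by blast
  have "Poly_Mapping.keys (pi ^ l) \<noteq> {}"
    using assms(2) by simp
  then obtain m where m: "m \<in> Poly_Mapping.keys (pi ^ l)" by blast
  obtain q where "\<And>N. tp (q N) \<in> A" "\<And>N. m + Poly_Mapping.single 0 N \<in> Poly_Mapping.keys (q N)"
    using A_element_ex[OF l] m by metis
  then show ?thesis
    using not_finitely_generated[OF assms(1)] by blast
qed

text \<open>A fraction over R[z] is expanded by a power of \<open>pi\<close> that makes the images
  of numerator and denominator polynomials.\<close>

lemma quot_field_A:
  assumes "pi \<noteq> 0"
  shows "quot_field A = Th ` Mz"
proof
  show "quot_field A \<subseteq> Th ` Mz"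
  proof
    fix y assume "y \<in> quot_field A"
    then obtain a b where "y = a / b" "a \<in> Th ` Mz" "b \<in> Th ` Mz"
      unfolding quot_field_def A_def by blast
    then obtain a' b' where "y = Th (a' / b')" "a' \<in> Mz" "b' \<in> Mz"
      by auto
    then show "y \<in> Th ` Mz"
      using subfield_divide[OF subfield_Mz] by blast
  qed
  show "Th ` Mz \<subseteq> quot_field A"
  proof
    fix y assume "y \<in> Th ` Mz"
    then obtain a b where ab: "a \<in> Rz" "b \<in> Rz" "b \<noteq> 0" "y = Th (to_fract a / to_fract b)"
      using Mz_quot by blast
    have clear: "\<exists>K. \<forall>j. tp pi ^ (K + j) * tp p \<in> to_fract ` kxz" if "p \<in> Rz" for p
      using that Rz_subset_kxz n by (intro pi_power_clears tp_in_loc) auto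
    obtain K L where KL: "\<And>j. tp pi ^ (K + j) * tp a \<in> to_fract ` kxz" "\<And>j. tp pi ^ (L + j) * tp b \<in> to_fract ` kxz"
      using clear[OF ab(1)] clear[OF ab(2)] by blast
    have "pi \<in> Rz"
      using pi_in_D D_subset_R subset_poly_values[OF subring_R, of "Var 0"] unfolding Rz_def by blast
    then have "pi ^ (K + L) * a \<in> Rz" "pi ^ (K + L) * b \<in> Rz"
      using ab(1,2) by (auto intro!: subring_mult subring_power subring_Rz)
    then have "tp (pi ^ (K + L) * a) \<in> A" "tp (pi ^ (K + L) * b) \<in> A"
      using KL(1)[of L] KL(2)[of K] by (auto dest!: A_memberI simp: add.commute)
    moreover have "y = tp (pi ^ (K + L) * a) / tp (pi ^ (K + L) * b)"
      using assms ab(3,4) by simp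
    moreover have "tp (pi ^ (K + L) * b) \<noteq> 0"
      using assms ab(3) by simp
    ultimately show "y \<in> quot_field A"
      unfolding quot_field_def by blast
  qed
qed

end

section \<open>Algebraic independence of f and g\<close>

definition lead_mon :: "'k::zero mpoly \<Rightarrow> (nat \<Rightarrow>\<^sub>0 nat)" where
  "lead_mon p = Max (Poly_Mapping.keys p)"

lemma lead_mon_in_keys: "p \<noteq> 0 \<Longrightarrow> lead_mon p \<in> Poly_Mapping.keys p"
  unfolding lead_mon_def by (intro Max_in) auto

lemma le_lead_mon: "m \<in> Poly_Mapping.keys p \<Longrightarrow> m \<le> lead_mon p"
  unfolding lead_mon_def by simp

text \<open>Addition of monomials is strictly monotone, so no other pair of monomials has the same
  sum as the two leading ones.\<close>

lemma lookup_mult_lead_mon: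
  fixes p q :: "'k::field mpoly"
  shows "Poly_Mapping.lookup (p * q) (lead_mon p + lead_mon q)
    = Poly_Mapping.lookup p (lead_mon p) * Poly_Mapping.lookup q (lead_mon q)"
proof (cases "p = 0 \<or> q = 0")
  case False
  let ?l = Poly_Mapping.lookup and ?k = Poly_Mapping.keys
  have eq: "m = lead_mon p \<and> m' = lead_mon q"
    if "m \<in> ?k p" "m' \<in> ?k q" "m + m' = lead_mon p + lead_mon q" for m m'
  proof -
    have "m \<le> lead_mon p" "m' \<le> lead_mon q"
      using that by (auto intro: le_lead_mon)
    then show ?thesis
      using that(3) add_less_le_mono[of m "lead_mon p" m' "lead_mon q"] add_le_less_mono[of m "lead_mon p" m' "lead_mon q"]
      by (auto simp: order.order_iff_strict)
  qed
  have "p * q = (\<Sum>m\<in>?k p. \<Sum>m'\<in>?k q. Poly_Mapping.single (m + m') (?l p m * ?l q m'))"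
    by (subst (1) poly_mapping_sum_single[of p], subst (1) poly_mapping_sum_single[of q]) (simp add: sum_product mult_single)
  then have "?l (p * q) (lead_mon p + lead_mon q)
    = (\<Sum>m\<in>?k p. \<Sum>m'\<in>?k q. if m = lead_mon p \<and> m' = lead_mon q then ?l p m * ?l q m' else 0)"
    by (simp add: lookup_sum lookup_single when_def) (intro sum.cong refl, use eq in auto)
  also have "\<dots> = (\<Sum>m\<in>?k p. if m = lead_mon p then ?l p m * ?l q (lead_mon q) else 0)"
    using False lead_mon_in_keys[of q] by (intro sum.cong refl) (auto simp: if_distrib cong: if_cong)
  also have "\<dots> = ?l p (lead_mon p) * ?l q (lead_mon q)"
    using False lead_mon_in_keys[of p] by simp
  finally show ?thesis .
qed auto

lemma lead_mon_mult:
  fixes p q :: "'k::field mpoly"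
  assumes "p \<noteq> 0" "q \<noteq> 0"
  shows "lead_mon (p * q) = lead_mon p + lead_mon q"
proof (rule antisym)
  have "lead_mon (p * q) \<in> Poly_Mapping.keys (p * q)"
    using assms by (intro lead_mon_in_keys) auto
  then obtain a b where "lead_mon (p * q) = a + b" "a \<in> Poly_Mapping.keys p" "b \<in> Poly_Mapping.keys q"
    using keys_mult[of p q] by auto
  then show "lead_mon (p * q) \<le> lead_mon p + lead_mon q"
    by (auto intro!: add_mono le_lead_mon)
  show "lead_mon p + lead_mon q \<le> lead_mon (p * q)"
    using assms lead_mon_in_keys[of p] lead_mon_in_keys[of q]
    by (intro le_lead_mon) (simp add: in_keys_iff lookup_mult_lead_mon)
qed

lemma lookup_lead_mon_power:
  fixes p :: "'k::field mpoly"
  assumes "p \<noteq> 0"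
  shows "Poly_Mapping.lookup (lead_mon (p ^ k)) i = k * Poly_Mapping.lookup (lead_mon p) i"
proof (induction k)
  case 0
  then show ?case by (simp add: lead_mon_def)
next
  case (Suc k)
  then show ?case using assms by (simp add: lead_mon_mult lookup_add)
qed

lemma lead_mon_single: "c \<noteq> 0 \<Longrightarrow> lead_mon (Poly_Mapping.single m c) = m"
  by (simp add: lead_mon_def)

lemma cancel_leading_term:
  fixes p q :: "'k::field mpoly"
  assumes "p \<noteq> 0" "lead_mon q = lead_mon p" 
    "Poly_Mapping.lookup q (lead_mon p) = Poly_Mapping.lookup p (lead_mon p)" "p - q \<noteq> 0"
  shows "lead_mon (p - q) < lead_mon p"
proof -
  have k: "lead_mon (p - q) \<in> Poly_Mapping.keys (p - q)"
    using assms(4) by (rule lead_mon_in_keys)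
  then have "lead_mon (p - q) \<noteq> lead_mon p"
    using assms(3) by (auto simp: in_keys_iff lookup_minus)
  moreover have "lead_mon (p - q) \<in> Poly_Mapping.keys p \<union> Poly_Mapping.keys q"
    using k by (auto simp: in_keys_iff lookup_minus)
  then have "lead_mon (p - q) \<le> lead_mon p"
    using assms(2) le_lead_mon by (metis UnE)
  ultimately show ?thesis by simp
qed

lemma monomial_lessE:
  assumes "m < (m' :: nat \<Rightarrow>\<^sub>0 nat)"
  obtains k where "Poly_Mapping.lookup m k < Poly_Mapping.lookup m' k" 
    "\<And>i. i < k \<Longrightarrow> Poly_Mapping.lookup m i = Poly_Mapping.lookup m' i"
  using assms that unfolding less_poly_mapping.rep_eq less_fun_def by blast

lemma monomial_zero_le: "(0 :: nat \<Rightarrow>\<^sub>0 nat) \<le> m"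
proof (rule ccontr)
  assume "\<not> 0 \<le> m"
  then have "m < 0" by simp
  then show False by (rule monomial_lessE) simp
qed

text \<open>On countably many variables the order is not well-founded, as the monomials of
  \<open>Var 0\<close>, \<open>Var 1\<close>, ... descend. Exponent lists of fixed length
  \<open>N\<close> are well-founded.\<close>

lemma monomial_less_lex:
  assumes "m < m'" "Poly_Mapping.keys m' \<subseteq> {..<N}"
  shows "(map (Poly_Mapping.lookup m) [0..<N], map (Poly_Mapping.lookup m') [0..<N]) \<in> lex less_than"
proof -
  obtain k where k: "Poly_Mapping.lookup m k < Poly_Mapping.lookup m' k" 
    "\<And>i. i < k \<Longrightarrow> Poly_Mapping.lookup m i = Poly_Mapping.lookup m' i"
    using monomial_lessE[OF assms(1)] by blast
  have "k \<in> Poly_Mapping.keys m'"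
    using k(1) by (simp add: in_keys_iff)
  then have "k < N" using assms(2) by auto
  then have "[0..<N] = [0..<k] @ k # [Suc k..<N]"
    by (metis less_imp_le_nat upt_conv_Cons upt_add_eq_append le_add_diff_inverse zero_le)
  then have A: "map (Poly_Mapping.lookup v) [0..<N] =
      map (Poly_Mapping.lookup v) [0..<k] @ Poly_Mapping.lookup v k # map (Poly_Mapping.lookup v) [Suc k..<N]" for v :: "nat \<Rightarrow>\<^sub>0 nat"
    by simp
  have B: "map (Poly_Mapping.lookup m') [0..<k] = map (Poly_Mapping.lookup m) [0..<k]"
    using k(2) by auto
  have "\<exists>xys x y xs' ys'. map (Poly_Mapping.lookup m) [0..<N] = xys @ x # xs' \<and>
      map (Poly_Mapping.lookup m') [0..<N] = xys @ y # ys' \<and> (x, y) \<in> less_than"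
    by (intro exI conjI) (rule A[of m], rule A[of m', unfolded B], simp add: k(1))
  then show ?thesis
    unfolding lex_conv by simp
qed

text \<open>Complete integral closedness of polynomial rings, by division with respect to the lexicographic order,
  which is a well-order on the monomials in finitely many variables.\<close>

lemma dvd_of_power_dvd:
  fixes a b d :: "'k::field mpoly"
  assumes V: "V \<subseteq> {..<N}" and b: "b \<in> polys_in V" "b \<noteq> 0" and d: "d \<noteq> 0"
    and "a \<in> polys_in V" "\<And>i. b ^ i dvd d * a ^ i"
  shows "\<exists>q\<in>polys_in V. a = b * q"
proof -
  have "wf (inv_image (lex less_than) (\<lambda>a. map (Poly_Mapping.lookup (lead_mon a)) [0..<N]))"
    by (intro wf_inv_image wf_lex wf_less_than)
  then show ?thesis
    using assms(5,6)
  proof (induction a rule: wf_induct_rule)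
    case (less a)
    show ?case
    proof (cases "a = 0")
      case True
      then show ?thesis by (intro bexI[of _ 0]) auto
    next
      case False
      let ?l = Poly_Mapping.lookup
      have le: "?l (lead_mon b) x \<le> ?l (lead_mon a) x" for x
      proof (rule ccontr)
        assume gt: "\<not> ?l (lead_mon b) x \<le> ?l (lead_mon a) x"
        \<comment> \<open>Leading monomials in \<open>d * a ^ i = b ^ i * e\<close> give i b_x \<le>
          d_x + i a_x for the exponents of the variable x. If b_x > a_x, this fails once i exceeds
          d_x.\<close>
        define i where "i = Suc (?l (lead_mon d) x)"
        obtain e where e: "d * a ^ i = b ^ i * e"
          using less.prems(2)[of i] by (elim dvdE)
        have "e \<noteq> 0"
          using e d False by auto
        then have "lead_mon d + lead_mon (a ^ i) = lead_mon (b ^ i) + lead_mon e"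
          using e d False b(2) by (metis lead_mon_mult power_not_zero)
        then have "?l (lead_mon d + lead_mon (a ^ i)) x = ?l (lead_mon (b ^ i) + lead_mon e) x"
          by simp
        then have "i * ?l (lead_mon b) x \<le> ?l (lead_mon d) x + i * ?l (lead_mon a) x"
          by (simp add: lookup_add lookup_lead_mon_power False b(2))
        moreover have "i * Suc (?l (lead_mon a) x) \<le> i * ?l (lead_mon b) x"
          using gt by (intro mult_le_mono2) simp
        ultimately show False by (simp add: i_def)
      qed
      define s where "s = lead_mon a - lead_mon b"
      have s: "lead_mon a = s + lead_mon b"
        by (rule poly_mapping_eqI) (simp add: s_def lookup_add lookup_minus le)
      define lc where "lc = ?l a (lead_mon a) / ?l b (lead_mon b)"
      have nz: "?l b (lead_mon b) \<noteq> 0" "?l a (lead_mon a) \<noteq> 0"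
        using lead_mon_in_keys[of b] lead_mon_in_keys[of a] b(2) False by (auto simp: in_keys_iff)
      then have "lc \<noteq> 0" by (simp add: lc_def)
      define c where "c = Poly_Mapping.single s lc"
      have "c \<noteq> 0"
        using \<open>lc \<noteq> 0\<close> by (metis c_def keys_single keys_zero insert_not_empty)
      have lmc: "lead_mon c = s"
        by (simp add: c_def lead_mon_single \<open>lc \<noteq> 0\<close>)
      have cb: "lead_mon (c * b) = lead_mon a" "?l (c * b) (lead_mon a) = ?l a (lead_mon a)"
        using \<open>c \<noteq> 0\<close> b(2) lookup_mult_lead_mon[of c b] nz
        by (simp_all add: lead_mon_mult lmc s) (simp add: c_def lc_def s)
      have c_in: "c \<in> polys_in V"
      proof -
        have "Poly_Mapping.keys (lead_mon a) \<subseteq> V"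
          using less.prems(1) lead_mon_in_keys[OF False] by (auto simp: polys_in_iff)
        then have "Poly_Mapping.keys s \<subseteq> V"
          by (auto simp: s in_keys_iff lookup_add)
        then show ?thesis by (simp add: polys_in_iff c_def)
      qed
      have "\<exists>q\<in>polys_in V. a - c * b = b * q"
      proof (cases "a - c * b = 0")
        case True
        then show ?thesis by (intro bexI[of _ 0]) auto
      next
        case nz': False
        have "lead_mon (a - c * b) < lead_mon a"
          using cancel_leading_term[OF False cb nz'] .
        then have "(a - c * b, a) \<in> inv_image (lex less_than) (\<lambda>a. map (?l (lead_mon a)) [0..<N])"
          using monomial_less_lex[of "lead_mon (a - c * b)" "lead_mon a" N] V less.prems(1) lead_mon_in_keys[OF False]
          by (auto simp: polys_in_iff)
        moreover have "a - c * b \<in> polys_in V"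
          using less.prems(1) c_in b(1) by (intro diff_in_polys mult_in_polys)
        \<comment> \<open>The remainder inherits the hypothesis: each summand of the binomial
          expansion contains d a^k b^(i-k), a multiple of b^k b^(i-k).\<close>
        moreover have "b ^ i dvd d * (a - c * b) ^ i" for i
        proof -
          have "d * (a - c * b) ^ i = (\<Sum>k\<le>i. of_nat (i choose k) * (- c) ^ (i - k) * ((d * a ^ k) * b ^ (i - k)))"
          proof -
            define c' where "c' = - c"
            have "a - c * b = a + c' * b" by (simp add: c'_def)
            then show ?thesis
              unfolding c'_def[symmetric] by (simp only:) (simp add: binomial_ring sum_distrib_left power_mult_distrib mult_ac)
          qed
          also have "b ^ i dvd \<dots>"
          proof (rule dvd_sum)
            fix k assume "k \<in> {..i}"
            then have "b ^ i = b ^ k * b ^ (i - k)"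
              by (simp flip: power_add)
            then show "b ^ i dvd of_nat (i choose k) * (- c) ^ (i - k) * ((d * a ^ k) * b ^ (i - k))"
              using less.prems(2)[of k] by (simp add: dvd_mult mult_dvd_mono)
          qed
          finally show ?thesis .
        qed
        ultimately show ?thesis by (rule less.IH)
      qed
      then obtain q where "q \<in> polys_in V" "a - c * b = b * q" by blast
      then have "a = b * (q + c)"
        by (simp add: algebra_simps)
      then show ?thesis
        using \<open>q \<in> polys_in V\<close> c_in add_in_polys by blast
    qed
  qed
qed

text \<open>Fraction-free Gaussian elimination: a vector \<open>v p\<close> with nonzero last
  coefficient serves to eliminate y_m from the others by cross-multiplication, and induction on
  \<open>m\<close> applies.\<close>

lemma linear_dependence:
  fixes v :: "'i \<Rightarrow> 'a::idom"
  assumes B: "is_subring B" and "finite I" "card I > m"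
    and "\<And>i j. i \<in> I \<Longrightarrow> c i j \<in> B" "\<And>i. i \<in> I \<Longrightarrow> v i = (\<Sum>j<m. c i j * y j)"
  shows "\<exists>e. (\<forall>i\<in>I. e i \<in> B) \<and> (\<exists>i\<in>I. e i \<noteq> 0) \<and> (\<Sum>i\<in>I. e i * v i) = 0"
  using assms(2-)
proof (induction m arbitrary: I v c)
  case 0
  then obtain i where "i \<in> I" by fastforce
  then show ?case
    using 0 subring_one[OF B] by (intro exI[of _ "\<lambda>_. 1"]) auto
next
  case (Suc m)
  show ?case
  proof (cases "\<forall>i\<in>I. c i m = 0")
    case True
    then show ?thesis
      using Suc.prems by (intro Suc.IH[of I c v]) auto
  next
    case False
    then obtain p where p: "p \<in> I" "c p m \<noteq> 0" by blast
    define I' where "I' = I - {p}"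
    define v' where "v' i = c p m * v i - c i m * v p" for i
    define c' where "c' i j = c p m * c i j - c i m * c p j" for i j
    have "\<exists>e. (\<forall>i\<in>I'. e i \<in> B) \<and> (\<exists>i\<in>I'. e i \<noteq> 0) \<and> (\<Sum>i\<in>I'. e i * v' i) = 0"
    proof (rule Suc.IH)
      show "finite I'" "m < card I'"
        using Suc.prems(1,2) p(1) by (auto simp: I'_def)
      show "c' i j \<in> B" if "i \<in> I'" for i j
        using Suc.prems(3) that p(1) B by (auto simp: c'_def I'_def intro!: subring_diff subring_mult)
      show "v' i = (\<Sum>j<m. c' i j * y j)" if "i \<in> I'" for i
        using Suc.prems(4) that p(1) by (simp add: v'_def c'_def I'_def algebra_simps sum_distrib_left sum_subtractf)
    qed
    then obtain e where e: "\<And>i. i \<in> I' \<Longrightarrow> e i \<in> B" "\<exists>i\<in>I'. e i \<noteq> 0" "(\<Sum>i\<in>I'. e i * v' i) = 0"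
      by blast
    \<comment> \<open>Expanding the relation between the \<open>v' i\<close> and collecting all
      multiples of \<open>v p\<close> gives these coefficients. They are not all 0, since
      \<open>c p m\<close> is nonzero in an integral domain.\<close>
    define e' where "e' i = (if i = p then - (\<Sum>i\<in>I'. e i * c i m) else e i * c p m)" for i
    have I: "I = insert p I'" "p \<notin> I'" "finite I'"
      using p(1) Suc.prems(1) by (auto simp: I'_def)
    have "e' i \<in> B" if "i \<in> I" for i
      using e(1) Suc.prems(3) that p(1) B I by (auto simp: e'_def intro!: subring_intros)
    moreover have "\<exists>i\<in>I. e' i \<noteq> 0"
      using e(2) p I by (auto simp: e'_def)
    moreover have "(\<Sum>i\<in>I. e' i * v i) = 0"
    proof -
      have "(\<Sum>i\<in>I. e' i * v i) = e' p * v p + (\<Sum>i\<in>I'. e' i * v i)"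
        by (simp add: I(1) sum.insert[OF I(3) I(2)])
      also have "(\<Sum>i\<in>I'. e' i * v i) = (\<Sum>i\<in>I'. e i * c p m * v i)"
        using I(2) by (intro sum.cong) (auto simp: e'_def)
      also have "e' p * v p + \<dots> = (\<Sum>i\<in>I'. e i * c p m * v i - e i * c i m * v p)"
        by (simp add: e'_def sum_subtractf sum_distrib_right)
      also have "\<dots> = (\<Sum>i\<in>I'. e i * v' i)"
        by (intro sum.cong) (auto simp: v'_def algebra_simps)
      finally have "(\<Sum>i\<in>I. e' i * v i) = (\<Sum>i\<in>I'. e i * v' i)" .
      then show ?thesis using e(3) by simp
    qed
    ultimately show ?thesis by blast
  qed
qed

text \<open>If \<open>T \<subseteq> k[x\<^sub>1]\<close> and \<open>u \<in> T\<close> has degree \<open>\<delta> > 0\<close>, then \<open>T[1/u] \<inter> k[x\<^sub>1]\<close> is a finite \<open>k[u]\<close>-module: it is generated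
  by one element of least degree for each residue class of degrees modulo \<open>\<delta>\<close>. So the powers of \<open>u\<close> in the
  denominators are bounded.\<close>

lemma bounded_denominators:
  fixes T :: "'k::field mpoly set"
  assumes T: "is_subring T" "range Const \<subseteq> T" "T \<subseteq> polys_in {1}" and u: "u \<in> T" "lead_mon u \<noteq> 0" and u0: "u \<noteq> 0"
  shows "\<exists>m. \<forall>y\<in>polys_in {1}. (\<exists>a. u ^ a * y \<in> T) \<longrightarrow> u ^ m * y \<in> T"
proof -
  define deg where "deg p = Poly_Mapping.lookup (lead_mon p) 1" for p :: "'k mpoly"
  define C where "C = {y \<in> polys_in {1}. \<exists>a. u ^ a * y \<in> T}"
  have lm: "lead_mon p = Poly_Mapping.single 1 (deg p)" if "p \<in> polys_in {1}" "p \<noteq> 0" for p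
  proof (rule poly_mapping_eqI)
    fix i
    show "Poly_Mapping.lookup (lead_mon p) i = Poly_Mapping.lookup (Poly_Mapping.single 1 (deg p)) i"
      using polys_in_lookup[OF that(1) lead_mon_in_keys[OF that(2)], of i] by (cases "i = 1") (auto simp: deg_def lookup_single when_def)
  qed
  have u1: "u \<in> polys_in {1}"
    using u T(3) by auto
  define \<delta> where "\<delta> = deg u"
  have \<delta>: "\<delta> > 0"
    using u(2) lm[OF u1 u0] by (auto simp: \<delta>_def intro: gr0I)
  \<comment> \<open>For a residue class without a nonzero element of \<open>C\<close> the
    implication is vacuous, so a choice can be made for every \<open>\<rho>\<close>.\<close>
  have "\<exists>y a. (\<exists>y'\<in>C - {0}. deg y' mod \<delta> = \<rho>) \<longrightarrow> y \<in> C - {0} \<and> deg y mod \<delta> = \<rho> \<and> u ^ a * y \<in> T \<and>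
      (\<forall>y'\<in>C - {0}. deg y' mod \<delta> = \<rho> \<longrightarrow> deg y \<le> deg y')" for \<rho>
  proof (cases "\<exists>y'\<in>C - {0}. deg y' mod \<delta> = \<rho>")
    case True
    then obtain y where "y \<in> C - {0} \<and> deg y mod \<delta> = \<rho>" "\<And>y'. y' \<in> C - {0} \<and> deg y' mod \<delta> = \<rho> \<Longrightarrow> deg y \<le> deg y'"
      using ex_has_least_nat[of "\<lambda>y. y \<in> C - {0} \<and> deg y mod \<delta> = \<rho>" _ deg] by blast
    moreover from this obtain a where "u ^ a * y \<in> T"
      by (auto simp: C_def)
    ultimately show ?thesis by blast
  qed blast
  then obtain Y e where Ye: "\<And>\<rho> y'. y' \<in> C - {0} \<Longrightarrow> deg y' mod \<delta> = \<rho> \<Longrightarrow>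
      Y \<rho> \<in> C - {0} \<and> deg (Y \<rho>) mod \<delta> = \<rho> \<and> u ^ e \<rho> * Y \<rho> \<in> T \<and> deg (Y \<rho>) \<le> deg y'"
    by metis
  \<comment> \<open>Any common upper bound of the exponents \<open>e \<rho>\<close> would
    do.\<close>
  define m where "m = (\<Sum>\<rho><\<delta>. e \<rho>)"
  have "u ^ m * y \<in> T" if "y \<in> C" for y
    using that
  proof (induction "deg y" arbitrary: y rule: less_induct)
    case less
    show ?case
    proof (cases "y = 0")
      case True
      then show ?thesis using T(1) subring_zero by simp
    next
      case False
      define \<rho> where "\<rho> = deg y mod \<delta>"
      define w where "w = Y \<rho>"
      have w: "w \<in> C" "w \<noteq> 0" "deg w mod \<delta> = \<rho>" "u ^ e \<rho> * w \<in> T" "deg w \<le> deg y"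
        using Ye[of y \<rho>] less.prems False by (auto simp: \<rho>_def w_def)
      have "e \<rho> \<le> m"
        unfolding m_def using \<delta> by (intro member_le_sum) (auto simp: \<rho>_def)
      then have "u ^ m = u ^ (m - e \<rho>) * u ^ e \<rho>"
        by (simp flip: power_add)
      then have wm: "u ^ m * w \<in> T"
        using w(4) T(1) u(1) by (simp add: mult.assoc subring_mult subring_power)
      \<comment> \<open>Multiplication by u^k lifts the generator \<open>w\<close> to the degree of
        \<open>y\<close>, so that a constant multiple cancels the leading term.\<close>
      define k where "k = (deg y - deg w) div \<delta>"
      have k: "deg y = k * \<delta> + deg w"
      proof -
        have "\<delta> dvd deg y - deg w"
          using w(3,5) mod_eq_dvd_iff_nat[of "deg w" "deg y" \<delta>] by (simp add: \<rho>_def)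
        then show ?thesis using w(5) by (simp add: k_def)
      qed
      let ?l = Poly_Mapping.lookup
      define q where "q = u ^ k * w"
      have q0: "q \<noteq> 0" using u0 w(2) by (simp add: q_def)
      have q1: "q \<in> polys_in {1}"
        using u1 w(1) by (auto simp: q_def C_def intro: mult_in_polys subring_power is_subring_polys_in)
      have y1: "y \<in> polys_in {1}"
        using less.prems by (simp add: C_def)
      have "deg q = deg y"
        using u0 w(2) k by (simp add: q_def deg_def lead_mon_mult lookup_add lookup_lead_mon_power \<delta>_def)
      then have lq: "lead_mon q = lead_mon y"
        using lm[OF q1 q0] lm[OF y1 False] by simp
      define \<kappa> where "\<kappa> = ?l y (lead_mon y) / ?l q (lead_mon y)"
      have nz: "?l q (lead_mon y) \<noteq> 0" "?l y (lead_mon y) \<noteq> 0"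
        using lead_mon_in_keys[OF q0] lead_mon_in_keys[OF False] by (auto simp: lq in_keys_iff)
      have "\<kappa> \<noteq> 0" using nz by (simp add: \<kappa>_def)
      have c: "lead_mon (Const \<kappa> * q) = lead_mon y" "?l (Const \<kappa> * q) (lead_mon y) = ?l y (lead_mon y)"
        using nz q0 \<open>\<kappa> \<noteq> 0\<close> by (simp_all add: lead_mon_mult lq lookup_Const_mult) (simp_all add: Const_def lead_mon_single \<kappa>_def)
      define y' where "y' = y - Const \<kappa> * q"
      have qT: "u ^ m * (Const \<kappa> * q) \<in> T"
      proof -
        have "u ^ m * (Const \<kappa> * q) = Const \<kappa> * (u ^ k * (u ^ m * w))"
          by (simp add: q_def mult_ac)
        moreover have "Const \<kappa> \<in> T" using T(2) by blast
        ultimately show ?thesis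
          using subring_mult[OF T(1) _ subring_mult[OF T(1) subring_power[OF T(1) u(1)] wm]] by metis
      qed
      have "u ^ m * y' \<in> T"
      proof (cases "y' = 0")
        case True
        then show ?thesis using T(1) subring_zero by simp
      next
        case nz': False
        have y'1: "y' \<in> polys_in {1}"
          unfolding y'_def by (intro diff_in_polys mult_in_polys y1 q1 Const_in_polys)
        have "lead_mon y' < lead_mon y"
          using cancel_leading_term[OF False c] nz' unfolding y'_def by blast
        then have "Poly_Mapping.single 1 (deg y') < (Poly_Mapping.single 1 (deg y) :: nat \<Rightarrow>\<^sub>0 nat)"
          using lm[OF y'1 nz'] lm[OF y1 False] by simp
        then have "deg y' < deg y"
          by (rule monomial_lessE) (auto simp: lookup_single when_def split: if_splits)
        \<comment> \<open>u^a takes \<open>y\<close> into \<open>T\<close> and u^m takes the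
          subtracted term into \<open>T\<close>, so their product takes \<open>y'\<close> into
          \<open>T\<close>.\<close>
        moreover have "y' \<in> C"
        proof -
          obtain a where a: "u ^ a * y \<in> T"
            using less.prems by (auto simp: C_def)
          have "u ^ (a + m) * y' = u ^ m * (u ^ a * y) - u ^ a * (u ^ m * (Const \<kappa> * q))"
            by (simp add: y'_def power_add algebra_simps)
          also have "\<dots> \<in> T"
            by (intro subring_diff[OF T(1)] subring_mult[OF T(1) subring_power[OF T(1) u(1)]] a qT)
          finally show ?thesis
            using y'1 by (auto simp: C_def)
        qed
        ultimately show ?thesis using less.hyps by blast
      qed
      then have "u ^ m * y' + u ^ m * (Const \<kappa> * q) \<in> T"
        using qT T(1) by (intro subring_add)
      then show ?thesis by (simp add: y'_def algebra_simps)
    qed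
  qed
  then show ?thesis
    by (auto simp: C_def)
qed

lemma lead_mon_0_const:
  assumes "lead_mon p = 0"
  shows "p \<in> range (Const :: 'k::comm_ring_1 \<Rightarrow> _)"
proof -
  have "m = 0" if "m \<in> Poly_Mapping.keys p" for m
    using le_lead_mon[OF that] assms monomial_zero_le[of m] by simp
  then have "p \<in> polys_in {}"
    by (auto simp: polys_in_iff)
  then show ?thesis by (simp add: polys_in_empty)
qed

text \<open>The constant term of \<open>Q\<close> is a multiple of \<open>u\<close>. Nonzero
  multiples of \<open>u\<close> have a nontrivial leading monomial, so the constant term is 0 and
  \<open>u\<close> can be cancelled.\<close>

lemma nonconstant_transcendental:
  fixes u :: "'k::field mpoly"
  assumes u: "u \<notin> range Const" and "Q \<in> polys_over (range Const)" "poly Q u = 0"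
  shows "Q = 0"
  using assms(2,3)
proof (induction Q)
  case (pCons a Q)
  obtain c where c: "a = Const c"
    using polys_over_pConsD[OF pCons.prems(1)] by blast
  have eq: "u * poly Q u = - Const c"
    using pCons.prems(2) c by (simp add: eq_neg_iff_add_eq_0 add.commute)
  have "c = 0"
  proof (rule ccontr)
    assume "c \<noteq> 0"
    then have "u * poly Q u \<noteq> 0" using eq by simp
    then have "lead_mon u + lead_mon (poly Q u) = lead_mon (- Const c)"
      using eq by (metis lead_mon_mult mult_zero_left mult_zero_right)
    also have "- Const c = Poly_Mapping.single 0 (- c)"
      by (simp add: Const_def single_uminus)
    also have "lead_mon \<dots> = 0"
      using \<open>c \<noteq> 0\<close> by (intro lead_mon_single) simp
    finally have "Poly_Mapping.lookup (lead_mon u + lead_mon (poly Q u)) i = 0" for i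
      by simp
    then have "lead_mon u = 0"
      by (intro poly_mapping_eqI) (simp add: lookup_add)
    then show False using lead_mon_0_const u by blast
  qed
  moreover have "u \<noteq> 0"
    using u by (metis Const.zero rangeI)
  ultimately have "poly Q u = 0"
    using eq by simp
  then have "Q = 0"
    using pCons.IH polys_over_pConsD[OF pCons.prems(1)] by blast
  then show ?case using c \<open>c = 0\<close> by simp
qed simp

section \<open>Nonvanishing of \<open>pi\<close>\<close>

context double_dagger
begin

text \<open>If \<open>epsz g\<close> were a constant c, then h would be the image of f/c, which lies
  in R.\<close>

lemma epsz_g_nonconstant:
  assumes h: "h \<notin> Rbar" "epsz f = h * epsz g"
  shows "epsz g \<notin> range Const"
proof
  assume "epsz g \<in> range Const"
  then obtain c where c: "epsz g = Const c" by blast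
  then have "c \<noteq> 0" using g(2) by auto
  have "epsz (f * Const (1 / c)) = h * (Const c * Const (1 / c))"
    using h(2) c by simp
  also have "\<dots> = h"
    using \<open>c \<noteq> 0\<close> by (simp flip: Const.mult)
  finally have "h = epsz (f * Const (1 / c))" by simp
  moreover have "f * Const (1 / c) \<in> R"
    by (intro subring_mult subring_R f Const_in_R)
  ultimately show False using h(1) by blast
qed

lemma epsz_kg_inj:
  assumes u: "epsz g \<notin> range Const" and c: "c \<in> kg" "epsz c = 0"
  shows "c = 0"
proof -
  obtain Q where Q: "Q \<in> polys_over (range Const)" "c = poly Q g"
    using c(1) unfolding poly_values_def by blast
  have "map_poly epsz Q = Q"
    using Q(1) by (intro poly_eqI) (auto simp: coeff_map_poly polys_over_def image_iff, metis epsz_Const)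
  then have "poly Q (epsz g) = 0"
    using c(2) by (simp add: Q(2) epsz.poly)
  then show ?thesis
    using nonconstant_transcendental[OF u Q(1)] Q(2) by simp
qed

text \<open>If \<open>pi = 0\<close>, then \<open>P\<close> is a monic equation for f over k[g],
  which reduces all higher powers of f.\<close>

lemma D_span:
  assumes pi: "pi = 0" and d: "d \<in> D"
  shows "\<exists>c. (\<forall>j. c j \<in> kg) \<and> d = (\<Sum>j<degree P. c j * f ^ j)"
proof -
  define S where "S = {d. \<exists>c. (\<forall>j. c j \<in> kg) \<and> d = (\<Sum>j<degree P. c j * f ^ j)}"
  have S0: "0 \<in> S"
    unfolding S_def using subring_zero[OF subring_kg] by (auto intro!: exI[of _ "\<lambda>_. 0"])
  have add: "a + b \<in> S" if "a \<in> S" "b \<in> S" for a b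
  proof -
    obtain c c' where "\<forall>j. c j \<in> kg" "a = (\<Sum>j<degree P. c j * f ^ j)" "\<forall>j. c' j \<in> kg" "b = (\<Sum>j<degree P. c' j * f ^ j)"
      using \<open>a \<in> S\<close> \<open>b \<in> S\<close> unfolding S_def by blast
    then show ?thesis
      unfolding S_def by (intro CollectI exI[of _ "\<lambda>j. c j + c' j"]) (auto simp: distrib_right sum.distrib intro: subring_add subring_kg)
  qed
  have sum: "sum F J \<in> S" if "\<And>j. j \<in> J \<Longrightarrow> F j \<in> S" for F and J :: "nat set"
    using that by (induction J rule: infinite_finite_induct) (auto intro: S0 add)
  have mon: "c * f ^ i \<in> S" if "c \<in> kg" for c i
    using that
  proof (induction i arbitrary: c rule: less_induct)
    case (less i)
    show ?case
    proof (cases "i < degree P")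
      case True
      have "c * f ^ i = (\<Sum>j<degree P. (if j = i then c else 0) * f ^ j)"
        using True by (simp add: if_distrib[of "\<lambda>x. x * _"] cong: if_cong)
      then show ?thesis
        unfolding S_def using less.prems subring_zero[OF subring_kg]
        by (intro CollectI exI[of _ "\<lambda>j. if j = i then c else 0"]) auto
    next
      case False
      have "(\<Sum>j<degree P. coeff P j * f ^ j) + f ^ degree P = 0"
        using P(1) pi by (simp add: poly_altdef lessThan_Suc_atMost[symmetric])
      then have fm: "f ^ degree P = (\<Sum>j<degree P. - coeff P j * f ^ j)"
        by (simp add: eq_neg_iff_add_eq_0 add.commute sum_negf)
      have "c * f ^ i = c * f ^ (i - degree P) * f ^ degree P"
        using False by (simp add: mult.assoc flip: power_add)
      also have "\<dots> = (\<Sum>j<degree P. (c * - coeff P j) * f ^ (i - degree P + j))"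
        unfolding fm by (simp add: sum_distrib_left power_add mult_ac)
      also have "\<dots> \<in> S"
      proof (intro sum less.IH)
        fix j assume "j \<in> {..<degree P}"
        then show "i - degree P + j < i" using False by auto
        show "c * - coeff P j \<in> kg"
          using P(2) less.prems by (intro subring_mult subring_uminus subring_kg) (auto simp: polys_over_def)
      qed
      finally show ?thesis .
    qed
  qed
  obtain Q where Q: "Q \<in> polys_over kg" "d = poly Q f"
    using d unfolding D_def poly_values_def[of kg] by blast
  have "d \<in> S"
    unfolding Q(2) poly_altdef by (intro sum mon) (use Q(1) in \<open>auto simp: polys_over_def\<close>)
  then show ?thesis by (simp add: S_def)
qed

text \<open>A nonzero w in the kernel satisfies no nontrivial relation over k[g]:
  \<open>epsz\<close> reduces a relation to its constant term, which is 0 since \<open>epsz\<close>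
  is injective on k[g], and w can be cancelled. But k[f,g] is spanned by finitely many elements over
  k[g].\<close>

lemma epsz_D_inj:
  assumes pi: "pi = 0" and u: "epsz g \<notin> range Const" and w: "w \<in> D" "epsz w = 0"
  shows "w = 0"
proof (rule ccontr)
  assume w0: "w \<noteq> 0"
  have no: "E = 0" if "E \<in> polys_over kg" "poly E w = 0" for E
    using that
  proof (induction E)
    case (pCons a E)
    note aE = polys_over_pConsD[OF pCons.prems(1)]
    have "epsz (a + w * poly E w) = epsz 0"
      using pCons.prems(2) by (simp only: poly_pCons)
    then have "epsz a = 0"
      by (simp add: w(2))
    then have "a = 0"
      by (rule epsz_kg_inj[OF u aE(1)])
    then have "poly E w = 0"
      using pCons.prems(2) w0 by simp
    then have "E = 0"
      by (rule pCons.IH[OF aE(2)])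
    then show ?case
      by (simp add: \<open>a = 0\<close>)
  qed simp
  define m where "m = degree P"
  have "\<exists>c. (\<forall>j. c j \<in> kg) \<and> w ^ i = (\<Sum>j<m. c j * f ^ j)" for i
    unfolding m_def by (rule D_span[OF pi subring_power[OF subring_D w(1)]])
  then obtain c where c: "\<And>i j. c i j \<in> kg" "\<And>i. w ^ i = (\<Sum>j<m. c i j * f ^ j)"
    by metis
  \<comment> \<open>The m + 1 powers of w from 0 to m lie in the span of m elements.\<close>
  obtain e where e: "\<forall>i\<in>{..m}. e i \<in> kg" "\<exists>i\<in>{..m}. e i \<noteq> 0" "(\<Sum>i\<in>{..m}. e i * w ^ i) = 0"
    using linear_dependence[OF subring_kg, of "{..m}" m c "\<lambda>i. w ^ i" "\<lambda>j. f ^ j"] c by auto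
  define E where "E = (\<Sum>i\<le>m. monom (e i) i)"
  have cE: "coeff E i = (if i \<le> m then e i else 0)" for i
    by (simp add: E_def coeff_sum)
  have "poly E w = 0"
    using e(3) by (simp add: E_def poly_sum poly_monom)
  moreover have "E \<in> polys_over kg"
    using e(1) subring_zero[OF subring_kg] by (auto simp: polys_over_def cE)
  ultimately have "E = 0" by (rule no[rotated])
  then have "coeff E i = 0" for i by simp
  then show False using e(2) cE by (metis atMost_iff)
qed

lemma pi_neq_0:
  assumes h: "h \<notin> Rbar" "epsz f = h * epsz g"
  shows "pi \<noteq> 0"
proof
  assume pi: "pi = 0"
  define u where "u = epsz g"
  have u: "u \<notin> range Const"
    unfolding u_def by (rule epsz_g_nonconstant[OF h])
  define T where "T = epsz ` D"
  have T: "is_subring T"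
    unfolding T_def by (intro subring_image epsz.rhom_axioms subring_D)
  have "T \<subseteq> polys_in {1}"
    using D_subset_R Rbar_subset unfolding T_def by blast
  moreover have "range Const \<subseteq> T"
    unfolding T_def using Const_in_kg kg_subset_D by (metis epsz_Const image_eqI image_subsetI subsetD)
  moreover have uT: "u \<in> T"
    unfolding T_def u_def using g_in_kg kg_subset_D by blast
  moreover have "lead_mon u \<noteq> 0"
    using u lead_mon_0_const by blast
  moreover have "u \<noteq> 0" using g(2) by (simp add: u_def)
  \<comment> \<open>One exponent \<open>m\<close> serves for all powers of h, since u^i h^i is the
    image of f^i and so lies in \<open>T\<close>.\<close>
  ultimately obtain m where m: "\<And>y a. y \<in> polys_in {1} \<Longrightarrow> u ^ a * y \<in> T \<Longrightarrow> u ^ m * y \<in> T"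
    using bounded_denominators[OF T] by metis
  have dvd: "g ^ i dvd g ^ m * f ^ i" for i
  proof -
    have "u ^ i * h ^ i \<in> T"
      using subring_power[OF subring_D f_in_D, of i] h(2) unfolding T_def u_def
      by (auto simp: image_iff power_mult_distrib mult.commute intro!: bexI[of _ "f ^ i"])
    then have "u ^ m * h ^ i \<in> T"
      using h_in by (intro m subring_power is_subring_polys_in)
    then obtain d where d: "d \<in> D" "u ^ m * h ^ i = epsz d"
      unfolding T_def by blast
    have gD: "g \<in> D" using g_in_kg kg_subset_D by blast
    \<comment> \<open>Injectivity on k[f,g] lifts this identity of images to g^m f^i = g^i
      d.\<close>
    have "epsz (g ^ m * f ^ i - g ^ i * d) = 0"
      using h(2) by (simp add: d(2)[symmetric] power_mult_distrib u_def mult_ac)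
    moreover have "g ^ m * f ^ i - g ^ i * d \<in> D"
      by (intro subring_diff subring_mult subring_power subring_D gD f_in_D d(1))
    ultimately have "g ^ m * f ^ i - g ^ i * d = 0"
      using epsz_D_inj[OF pi u[unfolded u_def]] by blast
    then show ?thesis by simp
  qed
  have "g \<noteq> 0" using g(2) by auto
  \<comment> \<open>f/g is almost integral over k[x], with g^m as common denominator.
    \<open>Suc n\<close> bounds the indices 1, ..., n strictly.\<close>
  have "\<exists>y\<in>kx. f = g * y"
    by (rule dvd_of_power_dvd[of _ "Suc n" g "g ^ m"]) (use dvd \<open>g \<noteq> 0\<close> f g R_subset_kx in auto)
  then obtain y where y: "y \<in> kx" "f = g * y" by blast
  have "to_fract y = to_fract f / to_fract g"
    using y(2) \<open>g \<noteq> 0\<close> by simp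
  then have "y \<in> R"
    using f g(1) y(1) subfield_divide[OF M_subfield] by (auto simp: R_def)
  moreover have "h = epsz y"
    using h(2) g(2) by (simp add: y(2))
  ultimately show False using h(1) by blast
qed

end

section \<open>Conclusion\<close>

theorem theorem1p4:
  fixes n :: nat
    and M :: "'k::field_char_0 mpoly fract set"
    and f g h \<pi> :: "'k mpoly"
    and P :: "'k mpoly poly"
    and t :: "nat \<Rightarrow> int"
    and kx kxz R Rbar :: "'k mpoly set"
    and A N :: "'k mpoly fract set"
  defines "kx \<equiv> polys_in {1..n}"
    and "kxz \<equiv> polys_in {0..n}"
    and "R \<equiv> {p \<in> kx. to_fract p \<in> M}"
    and "Rbar \<equiv> eps ` R"
    and "\<pi> \<equiv> poly P f"
    and "N \<equiv> theta n t h ` field_adjoin M {to_fract (Var 0)}"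
    and "A \<equiv> N \<inter> to_fract ` kxz"
  assumes n: "n \<ge> 1"
    and M: "is_subfield M" "constants \<subset> M" "M \<subset> quot_field (to_fract ` kx)"
    and dag: "M \<inter> to_fract ` kx = M \<inter> localize (to_fract ` kx) (to_fract (Var 1))"
      "quot_field (to_fract ` R) = M"
      "\<not> is_normal (to_fract ` Rbar)"
    and h: "h \<in> polys_in {1}" "to_fract h \<in> quot_field (to_fract ` Rbar)" "h \<notin> Rbar"
    and fg: "f \<in> R" "g \<in> R" "eps g \<noteq> 0" "to_fract (eps f) / to_fract (eps g) = to_fract h"
    and Pi: "lead_coeff P = 1" "\<forall>i. coeff P i \<in> ring_adjoin (range Const) {g}"
      "eps \<pi> = 0"
    and ddag: "theta n t h (to_fract (f - g * h)) \<in> to_fract ` kx"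
      "theta n t h (to_fract \<pi>) \<in> (\<lambda>p. to_fract (Var 1 * p)) ` kx"
  shows "\<not> finitely_generated_algebra constants A \<and> quot_field A = N"
proof -
  have f_kx: "f \<in> kx" and g_kx: "g \<in> kx"
    using fg(1,2) by (auto simp: R_def)
  have eps: "eps p = epsz p" if "p \<in> kx" for p
    using that unfolding kx_def by (rule eps_eq_epsz) simp
  interpret F: invariant_field n t h M
    by unfold_locales (use n M dag h(1) in \<open>simp_all add: kx_def R_def\<close>)
  have R: "F.R = R"
    by (simp add: F.R_def R_def kx_def)
  have Rbar: "Rbar = epsz ` F.R"
    unfolding Rbar_def R by (rule image_cong) (auto simp: R_def eps)
  have P_over: "P \<in> polys_over (poly_values (range Const) g)"
    using Pi(2) ring_adjoin_eq[OF subring_range_Const, of g] by (simp add: polys_over_def)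
  \<comment> \<open>\<pi> is shown to lie in k[x] first, because only there can \<open>eps\<close>
    be replaced by \<open>epsz\<close>.\<close>
  have "poly_values (range Const) g \<subseteq> F.R"
    using fg(2) F.Const_in_R R by (intro poly_values_subset F.subring_R) auto
  then have "poly_values (poly_values (range Const) g) f \<subseteq> F.R"
    by (rule poly_values_subset[OF F.subring_R]) (use fg(1) R in simp)
  moreover have "poly P f \<in> poly_values (poly_values (range Const) g) f"
    unfolding poly_values_def[of "poly_values _ _"] using P_over by (rule imageI)
  ultimately have "\<pi> \<in> kx"
    unfolding \<pi>_def using F.R_subset_kx by (auto simp: kx_def)
  interpret F: double_dagger n t h M f g P
    by unfold_locales
      (use fg Pi(1,3) ddag P_over R eps[OF \<open>\<pi> \<in> kx\<close>] eps[OF g_kx] in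
        \<open>simp_all add: kx_def \<pi>_def F.Th_to_fract del: to_fract.diff to_fract.mult to_fract_diff to_fract_mult\<close>)
  have h_notin: "h \<notin> epsz ` F.R"
    using h(3) by (simp add: Rbar)
  have "to_fract (eps f) = to_fract (h * eps g)"
    using fg(3,4) by (simp add: field_simps)
  then have "epsz f = h * epsz g"
    unfolding to_fract_eq_iff by (simp add: eps f_kx g_kx)
  then have "poly P f \<noteq> 0"
    by (rule F.pi_neq_0[OF h_notin])
  moreover have "A = F.A" "N = F.Th ` F.Mz"
    by (simp_all add: A_def N_def F.A_def F.Mz_def kxz_def)
  ultimately show ?thesis
    using F.A_not_fg[OF h_notin] F.quot_field_A by simp
qed

end
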